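(* Let $\lambda>0$, $T>0$, and let $\Theta$ be an upwards-closed graph property. Then the sequences of random geometric graphs $G_n(\lambda,\delta,T)$ and $G^*_n(\lambda,\delta)$ have the same weak and strong thresholds for $\Theta$: a function $\delta_\Theta:\mathbb{Z}^+\to\mathbb{R}^+$ is a weak (respectively strong) threshold function for $\Theta$ for $G_n(\lambda,\cdot,T)$ if and only if it is a weak (respectively strong) threshold function for $\Theta$ for $G^*_n(\lambda,\cdot)$.
   Context: Truncated exponential graph: $G_n(\lambda,r,T)$ is the graph whose vertices are $n$ i.i.d. random points with density $g_{\lambda,T}(x)=\lambda e^{-\lambda x}/(1-e^{-\lambda T})$, $0\le x\le T$, with an edge between two distinct vertices if and only if their distance is at most $r$. Graph $G^*_n$: let $p=1-e^{-\lambda T}$ and $N=N(n)=\lfloor n/p\rfloor$. Let $Z_1,Z_2,\dots$ be i.i.d. exponential random variables with mean $\lambda^{-1}$ and let $Z_{1,N}\le\dots\le Z_{N,N}$ be the ordered values of $Z_1,\dots,Z_N$. $G^*_n(\lambda,r)$ is the graph with vertex set $\{Z_{1,N},\dots,Z_{n,N}\}$ (the first $n$ of the $N$ ordered points), with an edge between two distinct vertices if and only if their distance is at most $r$. (It depends on $T$ through $N$.) For graphs $A,B$ on the same vertex set write $A\le B$ if the edge set of $A$ is a subset of that of $B$. A graph property $\Theta$ is upwards-closed if $A\le B$ and $A\in\Theta$ imply $B\in\Theta$. Thresholds: let $G_n(r)$ be a random geometric graph on $n$ vertices with cutoff $r$. For $\delta,\gamma:\mathbb{Z}^+\to\mathbb{R}^+$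 write $\delta\ll\gamma$ if $\delta(n)/\gamma(n)\to 0$, and $\delta\gg\gamma$ if $\gamma(n)/\delta(n)\to0$, as $n\to\infty$. A function $\delta_\Theta:\mathbb{Z}^+\to\mathbb{R}^+$ is a weak threshold function for $\Theta$ if for every $\delta:\mathbb{Z}^+\to\mathbb{R}^+$: $\delta\ll\delta_\Theta$ implies $\Pr(G_n(\delta(n))\in\Theta)=o(1)$, and $\delta\gg\delta_\Theta$ implies $\Pr(G_n(\delta(n))\in\Theta)=1-o(1)$. It is a strong threshold function for $\Theta$ if for every fixed $\epsilon>0$ (with $\epsilon<1$ in the first condition): $\Pr(G_n((1-\epsilon)\delta_\Theta(n))\in\Theta)=o(1)$ and $\Pr(G_n((1+\epsilon)\delta_\Theta(n))\in\Theta)=1-o(1)$. *)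

theory Defs
  imports "HOL-Probability.Probability"
begin

type_synonym 'v graph = "'v set \<times> 'v set set"

definition simple_graph :: "'v graph \<Rightarrow> bool" where
  "simple_graph A \<longleftrightarrow> finite (fst A) \<and> (\<forall>e\<in>snd A. e \<subseteq> fst A \<and> card e = 2)"

definition graph_iso :: "'v graph \<Rightarrow> 'w graph \<Rightarrow> bool" where
  "graph_iso A B \<longleftrightarrow> (\<exists>f. bij_betw f (fst A) (fst B) \<and> snd B = (\<lambda>e. f ` e) ` snd A)"

definition graph_le :: "'v graph \<Rightarrow> 'v graph \<Rightarrow> bool" where
  "graph_le A B \<longleftrightarrow> fst A = fst B \<and> snd A \<subseteq> snd B"

(* As usual, a graph property does not depend on the names of the vertices.  The random graphs
   below have real numbers as vertices; since every finite graph has an isomorphic copy on real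
   vertices, a property of real-vertex graphs is the same thing as a property of finite graphs. *)
definition graph_property :: "'v graph set \<Rightarrow> bool" where
  "graph_property \<Theta> \<longleftrightarrow> \<Theta> \<subseteq> Collect simple_graph \<and>
     (\<forall>A B. A \<in> \<Theta> \<and> simple_graph B \<and> graph_iso A B \<longrightarrow> B \<in> \<Theta>)"

definition upwards_closed :: "'v graph set \<Rightarrow> bool" where
  "upwards_closed \<Theta> \<longleftrightarrow>
     (\<forall>A B. simple_graph A \<and> simple_graph B \<and> graph_le A B \<and> A \<in> \<Theta> \<longrightarrow> B \<in> \<Theta>)"

definition geometric_graph :: "'v::metric_space set \<Rightarrow> real \<Rightarrow> 'v graph" where
  "geometric_graph V r = (V, {{x, y} | x y. x \<in> V \<and> y \<in> V \<and> x \<noteq> y \<and> dist x y \<le> r})"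

definition trunc_exp_density :: "real \<Rightarrow> real \<Rightarrow> real \<Rightarrow> real" where
  "trunc_exp_density l T x =
     (if 0 \<le> x \<and> x \<le> T then l * exp (- l * x) / (1 - exp (- l * T)) else 0)"

(* X n 0, ..., X n (n - 1) are the n random points of the n-th graph.  Coinciding points (a null
   event for continuous distributions) become one vertex. *)
definition trunc_exp_graph :: "(nat \<Rightarrow> nat \<Rightarrow> 'a \<Rightarrow> real) \<Rightarrow> nat \<Rightarrow> real \<Rightarrow> 'a \<Rightarrow> real graph" where
  "trunc_exp_graph X n r \<omega> = geometric_graph ((\<lambda>i. X n i \<omega>) ` {..<n}) r"

definition star_size :: "real \<Rightarrow> real \<Rightarrow> nat \<Rightarrow> nat" where
  "star_size l T n = nat \<lfloor>real n / (1 - exp (- l * T))\<rfloor>"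

(* The variables Z_1, Z_2, ... are indexed from 0 here.  For l, T > 0 we have star_size l T n \<ge> n,
   so the take really selects the n smallest of the points. *)
definition star_graph ::
  "real \<Rightarrow> real \<Rightarrow> (nat \<Rightarrow> 'a \<Rightarrow> real) \<Rightarrow> nat \<Rightarrow> real \<Rightarrow> 'a \<Rightarrow> real graph" where
  "star_graph l T Z n r \<omega> =
     geometric_graph (set (take n (sort (map (\<lambda>i. Z i \<omega>) [0..<star_size l T n])))) r"

(* Functions on the positive integers are represented by functions on nat whose value at 0 is
   irrelevant. *)
definition pos_fun :: "(nat \<Rightarrow> real) \<Rightarrow> bool" where
  "pos_fun \<delta> \<longleftrightarrow> (\<forall>n\<ge>1. \<delta> n > 0)"

definition much_less :: "(nat \<Rightarrow> real) \<Rightarrow> (nat \<Rightarrow> real) \<Rightarrow> bool" where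
  "much_less \<delta> \<gamma> \<longleftrightarrow> (\<lambda>n. \<delta> n / \<gamma> n) \<longlonglongrightarrow> 0"

definition weak_threshold ::
  "'a measure \<Rightarrow> (nat \<Rightarrow> real \<Rightarrow> 'a \<Rightarrow> 'v graph) \<Rightarrow> 'v graph set \<Rightarrow> (nat \<Rightarrow> real) \<Rightarrow> bool" where
  "weak_threshold M G \<Theta> \<delta>\<Theta> \<longleftrightarrow> pos_fun \<delta>\<Theta> \<and>
     (\<forall>\<delta>. pos_fun \<delta> \<longrightarrow>
        (much_less \<delta> \<delta>\<Theta> \<longrightarrow> (\<lambda>n. \<P>(\<omega> in M. G n (\<delta> n) \<omega> \<in> \<Theta>)) \<longlonglongrightarrow> 0) \<and>
        (much_less \<delta>\<Theta> \<delta> \<longrightarrow> (\<lambda>n. \<P>(\<omega> in M. G n (\<delta> n) \<omega> \<in> \<Theta>)) \<longlonglongrightarrow> 1))"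

definition strong_threshold ::
  "'a measure \<Rightarrow> (nat \<Rightarrow> real \<Rightarrow> 'a \<Rightarrow> 'v graph) \<Rightarrow> 'v graph set \<Rightarrow> (nat \<Rightarrow> real) \<Rightarrow> bool" where
  "strong_threshold M G \<Theta> \<delta>\<Theta> \<longleftrightarrow> pos_fun \<delta>\<Theta> \<and>
     (\<forall>\<epsilon>. 0 < \<epsilon> \<and> \<epsilon> < 1 \<longrightarrow>
        (\<lambda>n. \<P>(\<omega> in M. G n ((1 - \<epsilon>) * \<delta>\<Theta> n) \<omega> \<in> \<Theta>)) \<longlonglongrightarrow> 0) \<and>
     (\<forall>\<epsilon>>0. (\<lambda>n. \<P>(\<omega> in M. G n ((1 + \<epsilon>) * \<delta>\<Theta> n) \<omega> \<in> \<Theta>)) \<longlonglongrightarrow> 1)"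

end

theory Submission
  imports Defs
begin

text \<open>
  The two graphs are compared on vertex sets that have the same law up to a monotone change of scale
  close to the identity.

  Condition the \<open>N\<close> exponential points on the value \<open>y\<close> of the \<open>(n + 1)\<close>-st smallest of them.  The
  \<open>n\<close> smallest points then form, as a set, a sample of \<open>n\<close> independent points from the exponential
  law truncated at \<open>y\<close>.  So the starred graph is a mixture over \<open>y\<close> of truncated exponential
  graphs.  Since \<open>n / N\<close> tends to \<open>p = 1 - exp (- l * T)\<close>, which is the exponential distribution
  function at \<open>T\<close>, Hoeffding's inequality puts \<open>y\<close> within any fixed interval \<open>[a, b)\<close> around \<open>T\<close>,
  up to an error that vanishes as \<open>n\<close> grows.

  Truncations at different points are coupled by uniform variables: the quantile functions
  \<open>u \<mapsto> - ln (1 - (1 - exp (- l * y)) * u) / l\<close> turn the same uniform sample into samples truncated at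
  \<open>y\<close> and at \<open>T\<close>, and they stretch distances by a factor of at most \<open>K\<close> relative to each other as
  soon as the odds \<open>exp (l * y) - 1\<close> and \<open>exp (l * T) - 1\<close> are within a factor of \<open>K\<close>
  (\<open>dist_trunc_exp_quantile_le\<close>).  Hence every edge of one graph with cutoff \<open>r\<close> becomes an edge of
  the other one with cutoff \<open>K * r\<close>, and an upwards-closed property is preserved.

  Together, for every fixed \<open>K > 1\<close> the probability of \<open>\<Theta>\<close> in either model at cutoff \<open>r\<close> is at most
  its probability in the other model at cutoff \<open>K * r\<close> plus an error that tends to 0 and does not
  depend on \<open>r\<close> (\<open>lowest_exponential_vs_trunc_exp\<close>).  Both kinds of threshold are insensitive to
  such a change: a weak one to any constant factor, a strong one to factors close to 1.
\<close>

section \<open>Ranks in a finite family of reals\<close>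

text \<open>
  In the presence of ties there can be more than \<open>n\<close> of these indices, but their values are still
  those of the first \<open>n\<close> entries of the sorted family.
\<close>
definition lowest_indices :: "nat \<Rightarrow> 'i set \<Rightarrow> ('i \<Rightarrow> real) \<Rightarrow> 'i set" where
  "lowest_indices n I z = {i \<in> I. card {k \<in> I. z k < z i} < n}"

text \<open>
  With repeated values, the first copy of \<open>x\<close> in a sorted list stands at the position given by the
  number of strictly smaller entries, so strict comparison alone decides membership.
\<close>
lemma mem_take_sorted_iff:
  fixes xs :: "real list"
  assumes "sorted xs"
  shows "x \<in> set (take n xs) \<longleftrightarrow> x \<in> set xs \<and> length (filter (\<lambda>y. y < x) xs) < n"
  using assms
proof (induction xs arbitrary: n)
  case (Cons a xs)
  show ?case
  proof (cases n)
    case (Suc m)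
    have "filter (\<lambda>y. y < x) xs = []" if "x \<le> a"
      using Cons.prems that by (auto simp: filter_empty_conv)
    moreover have "a < x" if "x \<in> set xs" "a \<noteq> x"
      using Cons.prems that by force
    ultimately show ?thesis
      using Cons Suc by (auto dest: in_set_takeD)
  qed simp
qed simp

lemma set_take_sort_eq_lowest_indices:
  "set (take n (sort (map z [0..<N]))) = z ` lowest_indices n {..<N} z"
proof -
  have "length (filter (\<lambda>y. y < x) (sort (map z [0..<N]))) = card {k \<in> {..<N}. z k < x}" for x
  proof -
    have "length (filter (\<lambda>y. y < x) (sort (map z [0..<N])))
        = length (filter (\<lambda>k. z k < x) [0..<N])"
      by (simp add: filter_sort filter_map comp_def)
    also have "\<dots> = card (set (filter (\<lambda>k. z k < x) [0..<N]))"
      by (subst distinct_card) auto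
    finally show ?thesis
      by (simp add: conj_commute lessThan_iff flip: atLeast0LessThan)
  qed
  then show ?thesis
    by (auto simp: mem_take_sorted_iff lowest_indices_def)
qed

lemma lowest_indices_eq_below:
  assumes "finite I" "card {k \<in> I. z k < z j} = n"
  shows "lowest_indices n I z = {k \<in> I. z k < z j}"
proof (intro equalityI subsetI)
  fix i assume i: "i \<in> lowest_indices n I z"
  show "i \<in> {k \<in> I. z k < z j}"
  proof (rule ccontr)
    assume "i \<notin> {k \<in> I. z k < z j}"
    then have "{k \<in> I. z k < z j} \<subseteq> {k \<in> I. z k < z i}"
      using i by (auto simp: lowest_indices_def)
    from card_mono[OF _ this] show False
      using i assms by (auto simp: lowest_indices_def)
  qed
next
  fix i assume i: "i \<in> {k \<in> I. z k < z j}"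
  then have "{k \<in> I. z k < z i} \<subset> {k \<in> I. z k < z j}"
    by auto
  from psubset_card_mono[OF _ this] show "i \<in> lowest_indices n I z"
    using i assms by (auto simp: lowest_indices_def)
qed

text \<open>
  Without ties the rank is an injection into \<open>{..<card I}\<close>, and by counting it is onto.
\<close>
lemma ex_index_of_rank:
  fixes z :: "'i \<Rightarrow> real"
  assumes fin: "finite I" and inj: "inj_on z I" and n: "n < card I"
  shows "\<exists>j\<in>I. card {k \<in> I. z k < z j} = n"
proof -
  let ?r = "\<lambda>i. card {k \<in> I. z k < z i}"
  have less: "?r i < ?r j" if "i \<in> I" "z i < z j" for i j
    using that fin by (intro psubset_card_mono) auto
  have "inj_on ?r I"
  proof (rule inj_onI)
    fix i j assume ij: "i \<in> I" "j \<in> I" "?r i = ?r j"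
    then have "z i = z j"
      using less[of i j] less[of j i] by (cases "z i" "z j" rule: linorder_cases) auto
    then show "i = j" using inj ij by (auto dest: inj_onD)
  qed
  moreover have "?r ` I \<subseteq> {..<card I}"
    using fin by (auto intro!: psubset_card_mono)
  ultimately have "?r ` I = {..<card I}"
    by (intro card_subset_eq) (auto simp: card_image)
  then have "n \<in> ?r ` I" using n by simp
  then show ?thesis by auto
qed

lemma lowest_indices_restrict: "lowest_indices n I (\<lambda>i\<in>I. z i) = lowest_indices n I z"
  unfolding lowest_indices_def by (intro Collect_cong conj_cong refl arg_cong[of _ _ "\<lambda>S. card S < n"]) auto

section \<open>Measurable properties of random finite point sets\<close>

text \<open>
  Measurability is required for the images of finitely many real coordinates, with every finite index
  set allowed, because the indices of the \<open>n\<close> smallest points vary with the sample.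
\<close>
definition borel_point_property :: "(real set \<Rightarrow> bool) \<Rightarrow> bool" where
  "borel_point_property D \<longleftrightarrow>
     (\<forall>S :: nat set. finite S \<longrightarrow> {z \<in> space (PiM S (\<lambda>_. borel)). D (z ` S)} \<in> sets (PiM S (\<lambda>_. borel)))"

lemma borel_point_propertyD:
  assumes D: "borel_point_property D" and "finite (S :: nat set)" and sets: "sets \<mu> = sets borel"
  shows "{z \<in> space (PiM S (\<lambda>_. \<mu>)). D (z ` S)} \<in> sets (PiM S (\<lambda>_. \<mu>))"
proof -
  have "sets (PiM S (\<lambda>_. \<mu>)) = sets (PiM S (\<lambda>_. borel))"
    using sets by (intro sets_PiM_cong) auto
  then show ?thesis
    using D \<open>finite S\<close> sets_eq_imp_space_eq unfolding borel_point_property_def by metis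
qed

lemma sets_Collect_iff_const:
  "{z \<in> space M. Q z} \<in> sets M \<Longrightarrow> {z \<in> space M. Q z \<longleftrightarrow> c} \<in> sets M"
  by (cases c) (auto intro: sets.sets_Collect_neg)

lemma simple_graph_subgraph:
  "\<lbrakk>simple_graph C; fst B = fst C; snd B \<subseteq> snd C\<rbrakk> \<Longrightarrow> simple_graph B"
  by (auto simp: simple_graph_def)

text \<open>
  The map \<open>f u \<mapsto> g u\<close> carries the first graph to an isomorphic copy on the vertices of the second
  one, and this copy has no edge that the second graph lacks.
\<close>
lemma geometric_graph_transfer:
  fixes f :: "'i \<Rightarrow> real" and g :: "'i \<Rightarrow> real"
  assumes \<Theta>: "graph_property \<Theta>" "upwards_closed \<Theta>" and U: "finite U"
    and eq: "\<And>u v. \<lbrakk>u \<in> U; v \<in> U\<rbrakk> \<Longrightarrow> f u = f v \<longleftrightarrow> g u = g v"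
    and le: "\<And>u v. \<lbrakk>u \<in> U; v \<in> U; dist (f u) (f v) \<le> r\<rbrakk> \<Longrightarrow> dist (g u) (g v) \<le> r'"
    and f: "geometric_graph (f ` U) r \<in> \<Theta>"
  shows "geometric_graph (g ` U) r' \<in> \<Theta>"
proof -
  define \<phi> where "\<phi> = g \<circ> inv_into U f"
  have \<phi>: "\<phi> (f u) = g u" if "u \<in> U" for u
    using that eq[of "inv_into U f (f u)" u] by (simp add: \<phi>_def inv_into_into f_inv_into_f)
  have inj: "inj_on \<phi> (f ` U)"
    using eq by (auto simp: inj_on_def \<phi>)
  have image: "\<phi> ` f ` U = g ` U"
    by (force simp: \<phi> image_iff)
  let ?A = "geometric_graph (f ` U) r" and ?C = "geometric_graph (g ` U) r'"
  let ?B = "(g ` U, (\<lambda>e. \<phi> ` e) ` snd ?A)"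
  have simple: "simple_graph (geometric_graph V s)" if "finite V" for V :: "real set" and s
    using that by (auto simp: simple_graph_def geometric_graph_def)
  have B: "snd ?B \<subseteq> snd ?C"
  proof
    fix e assume "e \<in> snd ?B"
    then obtain u v where uv: "u \<in> U" "v \<in> U" "f u \<noteq> f v" "dist (f u) (f v) \<le> r" "e = \<phi> ` {f u, f v}"
      by (auto simp: geometric_graph_def)
    then have "e = {g u, g v}" "g u \<noteq> g v" "dist (g u) (g v) \<le> r'"
      using eq le by (auto simp: \<phi>)
    then show "e \<in> snd ?C"
      using uv(1,2) by (auto simp: geometric_graph_def)
  qed
  have "simple_graph ?B"
    by (rule simple_graph_subgraph[OF simple[of "g ` U" r'] _ B]) (simp_all add: U geometric_graph_def)
  moreover have "graph_iso ?A ?B"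
    unfolding graph_iso_def using inj image
    by (intro exI[of _ \<phi>]) (auto simp: bij_betw_def geometric_graph_def)
  ultimately have "?B \<in> \<Theta>"
    using \<Theta>(1) f unfolding graph_property_def by blast
  moreover have "graph_le ?B ?C"
    using B by (simp add: graph_le_def geometric_graph_def)
  ultimately show ?thesis
    using \<Theta>(2) \<open>simple_graph ?B\<close> simple[of "g ` U" r'] U unfolding upwards_closed_def by blast
qed

text \<open>
  Membership in an isomorphism-invariant property depends only on which pairs of sample points
  coincide and which are within distance \<open>r\<close>.  These are finitely many patterns, each described by
  finitely many closed conditions and their negations.
\<close>
lemma borel_point_property_geometric_graph:
  assumes \<Theta>: "graph_property \<Theta>" "upwards_closed \<Theta>"
  shows "borel_point_property (\<lambda>V. geometric_graph V r \<in> \<Theta>)"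
  unfolding borel_point_property_def
proof (intro allI impI)
  fix S :: "nat set" assume S: "finite S"
  let ?P = "PiM S (\<lambda>_. borel) :: (nat \<Rightarrow> real) measure"
  define close coincide where
    "close z = {(i, j) \<in> S \<times> S. dist (z i) (z j) \<le> r}" and
    "coincide z = {(i, j) \<in> S \<times> S. z i = z j}" for z :: "nat \<Rightarrow> real"
  define A where "A = {z \<in> space ?P. geometric_graph (z ` S) r \<in> \<Theta>}"
  have fin: "finite ((\<lambda>z. (close z, coincide z)) ` A)"
  proof (rule finite_subset)
    show "(\<lambda>z. (close z, coincide z)) ` A \<subseteq> Pow (S \<times> S) \<times> Pow (S \<times> S)"
      unfolding close_def coincide_def by blast
  qed (use S in simp)
  have same: "geometric_graph (z' ` S) r \<in> \<Theta>"
    if z: "geometric_graph (z ` S) r \<in> \<Theta>" "close z = close z'" "coincide z = coincide z'" for z z'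
  proof (rule geometric_graph_transfer[OF \<Theta> S _ _ z(1)])
    show "z u = z v \<longleftrightarrow> z' u = z' v" if "u \<in> S" "v \<in> S" for u v
      using z(3) that by (auto simp: coincide_def set_eq_iff)
    show "dist (z' u) (z' v) \<le> r" if "u \<in> S" "v \<in> S" "dist (z u) (z v) \<le> r" for u v
      using z(2) that by (auto simp: close_def set_eq_iff)
  qed
  have "{z \<in> space ?P. close z = close w \<and> coincide z = coincide w} \<in> sets ?P" for w
  proof -
    have "{z \<in> space ?P. close z = close w \<and> coincide z = coincide w}
        = {z \<in> space ?P. \<forall>i\<in>S. \<forall>j\<in>S. (dist (z i) (z j) \<le> r \<longleftrightarrow> (i, j) \<in> close w) \<and>
            (z i = z j \<longleftrightarrow> (i, j) \<in> coincide w)}"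
      by (auto simp: close_def coincide_def set_eq_iff)
    also have "\<dots> \<in> sets ?P"
    proof (intro sets.sets_Collect_finite_All S)
      fix i j assume "i \<in> S" "j \<in> S"
      then have m: "(\<lambda>z. z i) \<in> borel_measurable ?P" "(\<lambda>z. z j) \<in> borel_measurable ?P"
        by simp_all
      show "{z \<in> space ?P. (dist (z i) (z j) \<le> r \<longleftrightarrow> (i, j) \<in> close w) \<and>
            (z i = z j \<longleftrightarrow> (i, j) \<in> coincide w)} \<in> sets ?P"
        by (intro sets.sets_Collect_conj sets_Collect_iff_const borel_measurable_eq borel_measurable_le
            borel_measurable_dist borel_measurable_const m)
    qed
    finally show ?thesis .
  qed
  then have "(\<Union>w\<in>(\<lambda>z. (close z, coincide z)) ` A. {z \<in> space ?P. (close z, coincide z) = w}) \<in> sets ?P"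
    using fin by (intro sets.finite_UN) auto
  also have "(\<Union>w\<in>(\<lambda>z. (close z, coincide z)) ` A. {z \<in> space ?P. (close z, coincide z) = w}) = A"
    using same by (auto simp: A_def)
  finally have "A \<in> sets ?P" .
  then show "{z \<in> space ?P. geometric_graph (z ` S) r \<in> \<Theta>} \<in> sets ?P"
    by (simp add: A_def)
qed

lemma borel_point_property_not:
  assumes "borel_point_property D"
  shows "borel_point_property (\<lambda>V. \<not> D V)"
  using assms unfolding borel_point_property_def by (auto intro: sets.sets_Collect_neg)

section \<open>Finite product measures and independent samples\<close>

lemma measurable_PiM_coordinate:
  fixes \<mu> :: "real measure"
  assumes "sets \<mu> = sets borel" "i \<in> I"
  shows "(\<lambda>z. z i) \<in> borel_measurable (PiM I (\<lambda>_. \<mu>))"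
  using measurable_component_singleton[OF assms(2), of "\<lambda>_. \<mu>"] measurable_cong_sets[OF refl assms(1)]
  by auto

text \<open>
  Conditioning an independent sample on all its points lying in \<open>A\<close> again gives an independent
  sample, with each point conditioned separately.
\<close>
lemma PiM_uniform_measure:
  fixes \<mu> :: "'a measure"
  assumes \<mu>: "prob_space \<mu>" and A: "A \<in> sets \<mu>" "emeasure \<mu> A \<noteq> 0" and "finite S"
  shows "PiM S (\<lambda>_. uniform_measure \<mu> A) = uniform_measure (PiM S (\<lambda>_. \<mu>)) (PiE S (\<lambda>_. A))"
proof -
  interpret \<mu>: prob_space \<mu> by fact
  have prob: "prob_space (uniform_measure \<mu> A)"
    using A by (intro prob_space_uniform_measure) auto
  interpret U: product_prob_space "\<lambda>_. uniform_measure \<mu> A" S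
    by (intro product_prob_spaceI prob)
  interpret P: product_prob_space "\<lambda>_. \<mu>" S
    by (intro product_prob_spaceI \<mu>)
  have AE: "PiE S (\<lambda>_. A) \<in> sets (PiM S (\<lambda>_. \<mu>))"
    using A \<open>finite S\<close> by (intro sets_PiM_I_finite) auto
  have sets: "sets (PiM S (\<lambda>_. uniform_measure \<mu> A)) = sets (PiM S (\<lambda>_. \<mu>))"
    by (intro sets_PiM_cong) auto
  show ?thesis
  proof (rule sym, rule U.PiM_eqI[OF \<open>finite S\<close>])
    fix B assume B: "\<And>i. i \<in> S \<Longrightarrow> B i \<in> sets (uniform_measure \<mu> A)"
    have "emeasure (uniform_measure (PiM S (\<lambda>_. \<mu>)) (PiE S (\<lambda>_. A))) (PiE S B)
        = (\<Prod>i\<in>S. emeasure \<mu> (A \<inter> B i)) / (\<Prod>i\<in>S. emeasure \<mu> A)"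
      using A B AE \<open>finite S\<close>
      by (subst emeasure_uniform_measure)
         (auto intro!: sets_PiM_I_finite simp: PiE_Int P.emeasure_PiM)
    also have "\<dots> = (\<Prod>i\<in>S. emeasure \<mu> (A \<inter> B i) / emeasure \<mu> A)"
      using A(2) by (simp add: \<mu>.emeasure_eq_measure prod_ennreal prod_nonneg divide_ennreal
          zero_less_measure_iff prod_dividef ennreal_power)
    also have "\<dots> = (\<Prod>i\<in>S. emeasure (uniform_measure \<mu> A) (B i))"
      using A B by (intro prod.cong) auto
    finally show "emeasure (uniform_measure (PiM S (\<lambda>_. \<mu>)) (PiE S (\<lambda>_. A))) (PiE S B)
        = (\<Prod>i\<in>S. emeasure (uniform_measure \<mu> A) (B i))" .
  qed (simp add: sets)
qed

text \<open>
  A property of the point set ignores the labels of the points, so only the size of the sample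
  matters.
\<close>
lemma emeasure_PiM_point_property_reindex:
  fixes S S' :: "nat set"
  assumes "prob_space \<nu>" and sets: "sets \<nu> = sets borel" and D: "borel_point_property D"
    and S: "finite S" "finite S'" "card S = card S'"
  shows "emeasure (PiM S (\<lambda>_. \<nu>)) {z \<in> space (PiM S (\<lambda>_. \<nu>)). D (z ` S)}
       = emeasure (PiM S' (\<lambda>_. \<nu>)) {z \<in> space (PiM S' (\<lambda>_. \<nu>)). D (z ` S')}"
proof -
  obtain f where f: "bij_betw f S' S"
    using S finite_same_card_bij by metis
  have f': "inj_on f S'" "f \<in> S' \<rightarrow> S" "f ` S' = S"
    using f by (auto simp: bij_betw_def)
  have eq: "distr (PiM S (\<lambda>_. \<nu>)) (PiM S' (\<lambda>_. \<nu>)) (\<lambda>\<omega>. \<lambda>n\<in>S'. \<omega> (f n)) = PiM S' (\<lambda>_. \<nu>)"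
    using assms(1) f' by (intro distr_PiM_reindex) auto
  have m: "(\<lambda>\<omega>. \<lambda>n\<in>S'. \<omega> (f n)) \<in> measurable (PiM S (\<lambda>_. \<nu>)) (PiM S' (\<lambda>_. \<nu>))"
    using f' by (intro measurable_restrict measurable_component_singleton) auto
  have "emeasure (PiM S' (\<lambda>_. \<nu>)) {z \<in> space (PiM S' (\<lambda>_. \<nu>)). D (z ` S')}
      = emeasure (distr (PiM S (\<lambda>_. \<nu>)) (PiM S' (\<lambda>_. \<nu>)) (\<lambda>\<omega>. \<lambda>n\<in>S'. \<omega> (f n)))
          {z \<in> space (PiM S' (\<lambda>_. \<nu>)). D (z ` S')}"
    by (simp only: eq)
  also have "\<dots> = emeasure (PiM S (\<lambda>_. \<nu>)) {z \<in> space (PiM S (\<lambda>_. \<nu>)). D (z ` S)}"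
  proof (subst emeasure_distr[OF m borel_point_propertyD[OF D S(2) sets]], rule arg_cong[of _ _ "emeasure _"])
    have "(\<lambda>n\<in>S'. z (f n)) ` S' = z ` S" for z :: "nat \<Rightarrow> real"
      using f'(3) by auto
    then show "(\<lambda>\<omega>. \<lambda>n\<in>S'. \<omega> (f n)) -` {z \<in> space (PiM S' (\<lambda>_. \<nu>)). D (z ` S')} \<inter> space (PiM S (\<lambda>_. \<nu>))
        = {z \<in> space (PiM S (\<lambda>_. \<nu>)). D (z ` S)}"
      using measurable_space[OF m] by auto
  qed
  finally show ?thesis by simp
qed

text \<open>
  Fubini with one coordinate as the inner integral: for a tie with another coordinate, whose value is
  then fixed, it would have to hit a single point, which has measure 0.
\<close>
lemma AE_PiM_inj_on:
  fixes \<mu> :: "real measure"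
  assumes \<mu>: "prob_space \<mu>" and sets: "sets \<mu> = sets borel" and atomless: "\<And>x. emeasure \<mu> {x} = 0"
    and I: "finite I"
  shows "AE z in PiM I (\<lambda>_. \<mu>). inj_on z I"
proof -
  interpret P: product_sigma_finite "\<lambda>_. \<mu>"
    using prob_space_imp_sigma_finite[OF \<mu>] by (simp add: product_sigma_finite_def)
  have "AE z in PiM I (\<lambda>_. \<mu>). z i \<noteq> z j" if ij: "i \<in> I" "j \<in> I" "i \<noteq> j" for i j
  proof -
    define J where "J = I - {i}"
    have J: "I = insert i J" "i \<notin> J" "finite J" "j \<in> J"
      using ij I by (auto simp: J_def)
    have m: "{z \<in> space (PiM (insert i J) (\<lambda>_. \<mu>)). z i = z j} \<in> sets (PiM (insert i J) (\<lambda>_. \<mu>))"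
      using J by (intro borel_measurable_eq measurable_PiM_coordinate sets) auto
    have "emeasure (PiM (insert i J) (\<lambda>_. \<mu>)) {z \<in> space (PiM (insert i J) (\<lambda>_. \<mu>)). z i = z j}
        = (\<integral>\<^sup>+ z. indicator {z \<in> space (PiM (insert i J) (\<lambda>_. \<mu>)). z i = z j} z \<partial>PiM (insert i J) (\<lambda>_. \<mu>))"
      using m by simp
    also have "\<dots> = (\<integral>\<^sup>+ x. (\<integral>\<^sup>+ y. indicator {z \<in> space (PiM (insert i J) (\<lambda>_. \<mu>)). z i = z j} (x(i := y)) \<partial>\<mu>)
        \<partial>PiM J (\<lambda>_. \<mu>))"
      using J m by (intro P.product_nn_integral_insert) auto
    also have "\<dots> = (\<integral>\<^sup>+ x. 0 \<partial>PiM J (\<lambda>_. \<mu>))"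
    proof (intro nn_integral_cong)
      fix x
      have "(\<integral>\<^sup>+ y. indicator {z \<in> space (PiM (insert i J) (\<lambda>_. \<mu>)). z i = z j} (x(i := y)) \<partial>\<mu>)
          \<le> (\<integral>\<^sup>+ y. indicator {x j} y \<partial>\<mu>)"
        using J ij by (intro nn_integral_mono) (auto simp: indicator_def)
      also have "\<dots> = 0"
        using atomless by (simp add: sets)
      finally show "(\<integral>\<^sup>+ y. indicator {z \<in> space (PiM (insert i J) (\<lambda>_. \<mu>)). z i = z j} (x(i := y)) \<partial>\<mu>) = 0"
        by simp
    qed
    finally show ?thesis
      using m unfolding J(1)
      by (intro AE_I[where N = "{z \<in> space (PiM (insert i J) (\<lambda>_. \<mu>)). z i = z j}"]) auto
  qed
  then have "AE z in PiM I (\<lambda>_. \<mu>). \<forall>i\<in>I. \<forall>j\<in>I. i \<noteq> j \<longrightarrow> z i \<noteq> z j"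
    using I by (auto intro!: AE_finite_allI)
  then show ?thesis
    by eventually_elim (auto simp: inj_on_def)
qed

lemma prob_iid_eq_PiM:
  fixes X :: "'i \<Rightarrow> 'a \<Rightarrow> real"
  assumes M: "prob_space M" and indep: "prob_space.indep_vars M (\<lambda>_. borel) X I" and I: "I \<noteq> {}"
    and distr: "\<And>i. i \<in> I \<Longrightarrow> distr M borel (X i) = \<mu>" and sets: "sets \<mu> = sets borel"
    and A: "{z \<in> space (PiM I (\<lambda>_. \<mu>)). P z} \<in> sets (PiM I (\<lambda>_. \<mu>))"
  shows "\<P>(\<omega> in M. P (\<lambda>i\<in>I. X i \<omega>)) = \<P>(z in PiM I (\<lambda>_. \<mu>). P z)"
proof -
  interpret prob_space M by fact
  have sets_eq: "sets (PiM I (\<lambda>_. borel)) = sets (PiM I (\<lambda>_. \<mu>))"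
    using sets by (intro sets_PiM_cong) auto
  have rv: "random_variable borel (X i)" if "i \<in> I" for i
    using indep that by (auto simp: indep_vars_def)
  have "distr M (PiM I (\<lambda>_. borel)) (\<lambda>\<omega>. \<lambda>i\<in>I. X i \<omega>) = PiM I (\<lambda>i. distr M borel (X i))"
    using indep_vars_iff_distr_eq_PiM'[OF I, where M' = "\<lambda>_. borel" and X = X] rv indep by simp
  also have "\<dots> = PiM I (\<lambda>_. \<mu>)"
    by (intro PiM_cong distr refl)
  finally have eq: "distr M (PiM I (\<lambda>_. borel)) (\<lambda>\<omega>. \<lambda>i\<in>I. X i \<omega>) = PiM I (\<lambda>_. \<mu>)" .
  have m: "(\<lambda>\<omega>. \<lambda>i\<in>I. X i \<omega>) \<in> measurable M (PiM I (\<lambda>_. borel))"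
    by (intro measurable_restrict rv)
  have "measure (PiM I (\<lambda>_. \<mu>)) {z \<in> space (PiM I (\<lambda>_. \<mu>)). P z}
      = measure (distr M (PiM I (\<lambda>_. borel)) (\<lambda>\<omega>. \<lambda>i\<in>I. X i \<omega>)) {z \<in> space (PiM I (\<lambda>_. \<mu>)). P z}"
    by (simp only: eq)
  also have "\<dots> = measure M {\<omega> \<in> space M. P (\<lambda>i\<in>I. X i \<omega>)}"
    using A sets_eq measurable_space[OF m] sets_eq_imp_space_eq[OF sets_eq]
    by (subst measure_distr[OF m]) (auto intro!: arg_cong[of _ _ "measure M"])
  finally show ?thesis by simp
qed

lemma indep_vars_PiM_coordinates:
  assumes \<mu>: "prob_space \<mu>" and sets: "sets \<mu> = sets borel" and "I \<noteq> {}"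
  shows "prob_space.indep_vars (PiM I (\<lambda>_. \<mu>)) (\<lambda>_. borel) (\<lambda>i z. z i :: real) I"
proof -
  interpret P: prob_space "PiM I (\<lambda>_. \<mu>)" by (intro prob_space_PiM \<mu>)
  have rv: "(\<lambda>z. z i) \<in> measurable (PiM I (\<lambda>_. \<mu>)) borel" if "i \<in> I" for i
    by (rule measurable_PiM_coordinate[OF sets that])
  have "distr (PiM I (\<lambda>_. \<mu>)) (PiM I (\<lambda>_. borel)) (\<lambda>z. \<lambda>i\<in>I. z i)
      = distr (PiM I (\<lambda>_. \<mu>)) (PiM I (\<lambda>_. \<mu>)) (\<lambda>z. z)"
    using sets by (intro distr_cong sets_PiM_cong) (auto simp: space_PiM)
  also have "\<dots> = PiM I (\<lambda>i. \<mu>)" by simp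
  also have "\<dots> = PiM I (\<lambda>i. distr (PiM I (\<lambda>_. \<mu>)) borel (\<lambda>z. z i))"
  proof (intro PiM_cong refl)
    fix i assume "i \<in> I"
    then show "\<mu> = distr (PiM I (\<lambda>_. \<mu>)) borel (\<lambda>z. z i)"
      using distr_PiM_component[of I "\<lambda>_. \<mu>" i] \<mu> distr_cong[OF refl sets, of "PiM I (\<lambda>_. \<mu>)"] by metis
  qed
  finally show ?thesis
    using P.indep_vars_iff_distr_eq_PiM'[OF \<open>I \<noteq> {}\<close>, where M' = "\<lambda>_. borel" and X = "\<lambda>i z. z i"] rv by blast
qed

lemma sets_point_property_subset:
  fixes I :: "nat set"
  assumes sets: "sets \<mu> = sets borel" and fin: "finite I" and S: "S \<subseteq> I" and D: "borel_point_property D"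
  shows "{z \<in> space (PiM I (\<lambda>_. \<mu>)). D (z ` S)} \<in> sets (PiM I (\<lambda>_. \<mu>))"
proof -
  have m: "(\<lambda>z. restrict z S) \<in> measurable (PiM I (\<lambda>_. \<mu>)) (PiM S (\<lambda>_. \<mu>))"
    using S by (intro measurable_restrict_subset)
  have "finite S" using fin S finite_subset by auto
  from measurable_sets[OF m borel_point_propertyD[OF D this sets]]
  show ?thesis
    by (rule back_subst[of "\<lambda>X. X \<in> sets (PiM I (\<lambda>_. \<mu>))"])
       (use measurable_space[OF m] in auto)
qed

lemma sets_Collect_PiM_less:
  fixes \<mu> :: "real measure"
  assumes sets: "sets \<mu> = sets borel" and "i \<in> I" "k \<in> I"
  shows "{z \<in> space (PiM I (\<lambda>_. \<mu>)). z k < z i} \<in> sets (PiM I (\<lambda>_. \<mu>))"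
    "{z \<in> space (PiM I (\<lambda>_. \<mu>)). z k < c} \<in> sets (PiM I (\<lambda>_. \<mu>))"
proof -
  note measurable_PiM_coordinate[OF sets]
  note borel_measurable_less[OF this this] borel_measurable_less[OF this borel_measurable_const]
  then show "{z \<in> space (PiM I (\<lambda>_. \<mu>)). z k < z i} \<in> sets (PiM I (\<lambda>_. \<mu>))"
    "{z \<in> space (PiM I (\<lambda>_. \<mu>)). z k < c} \<in> sets (PiM I (\<lambda>_. \<mu>))"
    using assms by auto
qed

lemma measurable_card_Collect:
  fixes I :: "nat set"
  assumes "\<And>k. k \<in> I \<Longrightarrow> {z \<in> space M. Q k z} \<in> sets M"
  shows "(\<lambda>z. card {k \<in> I. Q k z}) \<in> measurable M (count_space UNIV)"
proof (rule measurable_card)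
  fix k show "{z \<in> space M. k \<in> {k \<in> I. Q k z}} \<in> sets M"
    using assms by (cases "k \<in> I") auto
qed

lemma sets_Collect_card_less:
  fixes I :: "nat set"
  assumes "\<And>k. k \<in> I \<Longrightarrow> {z \<in> space M. Q k z} \<in> sets M"
  shows "{z \<in> space M. card {k \<in> I. Q k z} < n} \<in> sets M"
    "{z \<in> space M. n < card {k \<in> I. Q k z}} \<in> sets M"
proof -
  let ?f = "\<lambda>z. card {k \<in> I. Q k z}"
  have m: "?f \<in> measurable M (count_space UNIV)"
    by (rule measurable_card_Collect) fact
  have "{z \<in> space M. ?f z < n} = ?f -` {..<n} \<inter> space M" "{z \<in> space M. n < ?f z} = ?f -` {n<..} \<inter> space M"
    by auto
  then show "{z \<in> space M. ?f z < n} \<in> sets M" "{z \<in> space M. n < ?f z} \<in> sets M"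
    by (simp_all only:) (rule measurable_sets[OF m]; simp)+
qed

lemma sets_lowest_points:
  fixes \<mu> :: "real measure" and I :: "nat set"
  assumes D: "borel_point_property D" and sets: "sets \<mu> = sets borel" and I: "finite I"
  shows "{z \<in> space (PiM I (\<lambda>_. \<mu>)). D (z ` lowest_indices n I z)} \<in> sets (PiM I (\<lambda>_. \<mu>))"
proof -
  let ?P = "PiM I (\<lambda>_. \<mu>)"
  have low: "lowest_indices n I z \<subseteq> I" for z
    by (auto simp: lowest_indices_def)
  have "{z \<in> space ?P. lowest_indices n I z = S \<and> D (z ` S)} \<in> sets ?P" if S: "S \<subseteq> I" for S
  proof (intro sets.sets_Collect_conj sets_point_property_subset sets I S D)
    have "{z \<in> space ?P. lowest_indices n I z = S}
        = {z \<in> space ?P. \<forall>i\<in>I. card {k \<in> I. z k < z i} < n \<longleftrightarrow> i \<in> S}"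
      using S by (auto simp: lowest_indices_def)
    also have "\<dots> \<in> sets ?P"
      by (intro sets.sets_Collect_finite_All I sets_Collect_iff_const sets_Collect_card_less(1)
          sets_Collect_PiM_less(1)[OF sets])
    finally show "{z \<in> space ?P. lowest_indices n I z = S} \<in> sets ?P" .
  qed
  then have "(\<Union>S\<in>Pow I. {z \<in> space ?P. lowest_indices n I z = S \<and> D (z ` S)}) \<in> sets ?P"
    using I by (intro sets.finite_UN) auto
  also have "(\<Union>S\<in>Pow I. {z \<in> space ?P. lowest_indices n I z = S \<and> D (z ` S)})
      = {z \<in> space ?P. D (z ` lowest_indices n I z)}"
    using low by blast
  finally show ?thesis .
qed

section \<open>Conditioning on the smallest discarded point\<close>

text \<open>
  Given that all points of a sample lie below \<open>y\<close>, they are independent points with the law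
  truncated at \<open>y\<close>, whatever the index set \<open>S\<close>; the claim is this statement multiplied out.
\<close>
lemma emeasure_PiM_below_le:
  fixes \<mu> :: "real measure" and S :: "nat set"
  assumes \<mu>: "prob_space \<mu>" and sets: "sets \<mu> = sets borel" and D: "borel_point_property D"
    and y: "emeasure \<mu> {..<y} \<noteq> 0" and S: "finite S" "card S = n"
    and q: "emeasure (PiM {..<n} (\<lambda>_. uniform_measure \<mu> {..<y}))
      {z \<in> space (PiM {..<n} (\<lambda>_. uniform_measure \<mu> {..<y})). D (z ` {..<n})} \<le> q"
  shows "emeasure (PiM S (\<lambda>_. \<mu>)) {z \<in> space (PiM S (\<lambda>_. \<mu>)). D (z ` S) \<and> (\<forall>i\<in>S. z i < y)}
       \<le> q * emeasure (PiM S (\<lambda>_. \<mu>)) {z \<in> space (PiM S (\<lambda>_. \<mu>)). \<forall>i\<in>S. z i < y}"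
proof -
  interpret \<mu>: prob_space \<mu> by fact
  interpret P: product_prob_space "\<lambda>_. \<mu>" S
    by (intro product_prob_spaceI \<mu>)
  interpret PS: prob_space "PiM S (\<lambda>_. \<mu>)"
    by (intro prob_space_PiM \<mu>)
  let ?U = "uniform_measure \<mu> {..<y}" and ?A = "PiE S (\<lambda>_. {..<y})"
  let ?B = "{z \<in> space (PiM S (\<lambda>_. \<mu>)). D (z ` S)}"
  have space: "space \<mu> = UNIV"
    using sets_eq_imp_space_eq[OF sets] by simp
  have meas: "{..<y} \<in> sets \<mu>" by (simp add: sets)
  have prob: "prob_space ?U"
    using y meas by (intro prob_space_uniform_measure) auto
  have B: "?B \<in> sets (PiM S (\<lambda>_. \<mu>))"
    by (rule borel_point_propertyD[OF D S(1) sets])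
  have A: "?A \<in> sets (PiM S (\<lambda>_. \<mu>))"
    using meas S by (intro sets_PiM_I_finite) auto
  have A0: "emeasure (PiM S (\<lambda>_. \<mu>)) ?A \<noteq> 0"
    using meas y S by (simp add: P.emeasure_PiM)
  have AB: "{z \<in> space (PiM S (\<lambda>_. \<mu>)). D (z ` S) \<and> (\<forall>i\<in>S. z i < y)} = ?A \<inter> ?B"
    "{z \<in> space (PiM S (\<lambda>_. \<mu>)). \<forall>i\<in>S. z i < y} = ?A"
    by (auto simp: space_PiM space PiE_iff extensional_def)
  have "emeasure (PiM S (\<lambda>_. \<mu>)) (?A \<inter> ?B) / emeasure (PiM S (\<lambda>_. \<mu>)) ?A
      = emeasure (uniform_measure (PiM S (\<lambda>_. \<mu>)) ?A) ?B"
    using A B by simp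
  also have "\<dots> = emeasure (PiM S (\<lambda>_. ?U)) ?B"
    using PiM_uniform_measure[OF \<mu> meas y S(1)] by simp
  also have "\<dots> = emeasure (PiM S (\<lambda>_. ?U)) {z \<in> space (PiM S (\<lambda>_. ?U)). D (z ` S)}"
    by (simp add: space_PiM)
  also have "\<dots> \<le> q"
    using q emeasure_PiM_point_property_reindex[OF prob _ D S(1), of "{..<n}"] S sets by simp
  finally have "emeasure (PiM S (\<lambda>_. \<mu>)) (?A \<inter> ?B) / emeasure (PiM S (\<lambda>_. \<mu>)) ?A
      * emeasure (PiM S (\<lambda>_. \<mu>)) ?A \<le> q * emeasure (PiM S (\<lambda>_. \<mu>)) ?A"
    by (rule mult_right_mono) simp
  then show ?thesis
    unfolding AB using A0 by (simp add: ennreal_divide_times less_top[symmetric])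
qed

text \<open>
  The point with index \<open>j\<close> lies in \<open>[a, b)\<close> and cuts the sample into the points with indices in
  \<open>S\<close>, which are smaller, and all others, which are larger.  For varying \<open>j\<close> and for \<open>S\<close> of size
  \<open>n\<close> these events are disjoint.  They split the samples without ties whose \<open>(n + 1)\<close>-st smallest point
  lies in \<open>[a, b)\<close> according to the index of that point and the indices of the \<open>n\<close> points below it.
\<close>
definition cut_event :: "real measure \<Rightarrow> nat set \<Rightarrow> real \<Rightarrow> real \<Rightarrow> nat \<Rightarrow> nat set \<Rightarrow> (nat \<Rightarrow> real) set" where
  "cut_event \<mu> I a b j S = {z \<in> space (PiM I (\<lambda>_. \<mu>)).
     a \<le> z j \<and> z j < b \<and> (\<forall>i\<in>S. z i < z j) \<and> (\<forall>i\<in>I - S - {j}. z j < z i)}"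

lemma cut_event_below:
  assumes "z \<in> cut_event \<mu> I a b j S" "S \<subseteq> I - {j}" "j \<in> I"
  shows "{k \<in> I. z k < z j} = S"
proof -
  have "z i < z j \<longleftrightarrow> i \<in> S" if "i \<in> I" for i
    using assms that unfolding cut_event_def by (cases "i = j"; cases "i \<in> S") (auto dest: less_not_sym)
  then show ?thesis using assms(2) by auto
qed

lemma cut_event_disjoint:
  assumes "finite I" "z \<in> cut_event \<mu> I a b j S" "z \<in> cut_event \<mu> I a b j' S'"
    "S \<subseteq> I - {j}" "S' \<subseteq> I - {j'}" "j \<in> I" "j' \<in> I" "card S = card S'"
  shows "j = j' \<and> S = S'"
proof -
  have S: "{k \<in> I. z k < z j} = S" "{k \<in> I. z k < z j'} = S'"
    using assms cut_event_below by blast+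
  have fin: "finite S" "finite S'"
    using S assms(1) by auto
  have "z j = z j'"
  proof (rule linorder_cases)
    assume "z j < z j'"
    then have "S \<subset> S'" unfolding S[symmetric] using assms(6) by auto
    from psubset_card_mono[OF fin(2) this] show ?thesis using assms(8) by simp
  next
    assume "z j' < z j"
    then have "S' \<subset> S" unfolding S[symmetric] using assms(7) by auto
    from psubset_card_mono[OF fin(1) this] show ?thesis using assms(8) by simp
  qed
  then have "S = S'" "j' \<notin> S"
    unfolding S[symmetric] by auto
  moreover have "j = j'"
    using assms(2,7) \<open>z j = z j'\<close> \<open>j' \<notin> S\<close> unfolding cut_event_def by (cases "j = j'") auto
  ultimately show ?thesis by simp
qed

text \<open>
  If at most \<open>n\<close> points lie below \<open>a\<close> and more than \<open>n\<close> lie below \<open>b\<close>, then the \<open>(n + 1)\<close>-st smallest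
  point lies in \<open>[a, b)\<close>.
\<close>
lemma ex_cut_event:
  assumes z: "z \<in> space (PiM I (\<lambda>_. \<mu>))" and fin: "finite I" and inj: "inj_on z I"
    and a: "card {i \<in> I. z i < a} \<le> n" and b: "n < card {i \<in> I. z i < b}"
  shows "\<exists>j\<in>I. lowest_indices n I z \<subseteq> I - {j} \<and> card (lowest_indices n I z) = n \<and> z \<in> cut_event \<mu> I a b j (lowest_indices n I z)"
proof -
  have "n < card I"
    using b card_mono[OF fin, of "{i \<in> I. z i < b}"] by (simp add: subset_eq)
  then obtain j where j: "j \<in> I" "card {k \<in> I. z k < z j} = n"
    using ex_index_of_rank[OF fin inj] by auto
  have low: "lowest_indices n I z = {k \<in> I. z k < z j}"
    by (rule lowest_indices_eq_below) (use fin j in auto)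
  have "a \<le> z j"
  proof (rule ccontr)
    assume "\<not> a \<le> z j"
    then have "insert j {k \<in> I. z k < z j} \<subseteq> {i \<in> I. z i < a}"
      using j by auto
    from card_mono[OF _ this] show False
      using fin j a by simp
  qed
  moreover have "z j < b"
  proof (rule ccontr)
    assume "\<not> z j < b"
    then have "{i \<in> I. z i < b} \<subseteq> {k \<in> I. z k < z j}"
      by auto
    from card_mono[OF _ this] show False
      using fin j b by simp
  qed
  moreover have "z j < z i" if "i \<in> I" "\<not> z i < z j" "i \<noteq> j" for i
    using inj_onD[OF inj, of i j] that j by (metis linorder_neqE_linordered_idom)
  ultimately show ?thesis
    using j z by (intro bexI[of _ j]) (auto simp: low cut_event_def)
qed

lemma sets_cut_event:
  assumes sets: "sets \<mu> = sets borel" and fin: "finite I" and S: "S \<subseteq> I" "j \<in> I"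
  shows "cut_event \<mu> I a b j S \<in> sets (PiM I (\<lambda>_. \<mu>))"
  unfolding cut_event_def
  by (intro sets.sets_Collect_conj sets.sets_Collect_finite_All borel_measurable_less borel_measurable_le
      borel_measurable_const measurable_PiM_coordinate[OF sets])
     (use S fin in \<open>auto intro: finite_subset\<close>)

text \<open>
  Fubini, with the points outside \<open>S\<close> fixed first: once \<open>z j = y\<close> is known, the cut event only asks
  the points in \<open>S\<close> to lie below \<open>y\<close>, and there the bound for samples truncated at \<open>y\<close>
  applies.
\<close>
lemma emeasure_cut_event_le:
  fixes \<mu> :: "real measure" and I :: "nat set"
  assumes \<mu>: "prob_space \<mu>" and sets: "sets \<mu> = sets borel" and D: "borel_point_property D"
    and a: "emeasure \<mu> {..<a} \<noteq> 0" 
    and q: "\<And>y. \<lbrakk>a \<le> y; y < b\<rbrakk> \<Longrightarrow> emeasure (PiM {..<n} (\<lambda>_. uniform_measure \<mu> {..<y}))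
      {z \<in> space (PiM {..<n} (\<lambda>_. uniform_measure \<mu> {..<y})). D (z ` {..<n})} \<le> q"
    and I: "finite I" "S \<subseteq> I - {j}" "j \<in> I" "card S = n"
  shows "emeasure (PiM I (\<lambda>_. \<mu>)) ({z \<in> space (PiM I (\<lambda>_. \<mu>)). D (z ` S)} \<inter> cut_event \<mu> I a b j S)
       \<le> q * emeasure (PiM I (\<lambda>_. \<mu>)) (cut_event \<mu> I a b j S)"
proof -
  interpret P: product_sigma_finite "\<lambda>_. \<mu>"
    using prob_space_imp_sigma_finite[OF \<mu>] by (simp add: product_sigma_finite_def)
  \<comment> \<open>\<open>R\<close> contains \<open>j\<close>; its coordinates are integrated last.\<close>
  define R where "R = I - S"
  have R: "R \<inter> S = {}" "finite R" "finite S" "R \<union> S = I" "j \<in> R"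
    using I finite_subset by (auto simp: R_def)
  let ?E = "{z \<in> space (PiM I (\<lambda>_. \<mu>)). D (z ` S)} \<inter> cut_event \<mu> I a b j S"
  have C: "cut_event \<mu> I a b j S \<in> sets (PiM I (\<lambda>_. \<mu>))"
    using I sets by (intro sets_cut_event) auto
  have E: "?E \<in> sets (PiM I (\<lambda>_. \<mu>))"
    using I sets D C by (intro sets.Int sets_point_property_subset) auto
  have fold: "emeasure (PiM I (\<lambda>_. \<mu>)) A
      = (\<integral>\<^sup>+ x. (\<integral>\<^sup>+ y. indicator A (merge R S (x, y)) \<partial>PiM S (\<lambda>_. \<mu>)) \<partial>PiM R (\<lambda>_. \<mu>))"
    if "A \<in> sets (PiM I (\<lambda>_. \<mu>))" for A
    using P.product_nn_integral_fold[OF R(1-3), of "indicator A"] that R(4) by simp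
  have meas: "(\<lambda>x. \<integral>\<^sup>+ y. indicator (cut_event \<mu> I a b j S) (merge R S (x, y)) \<partial>PiM S (\<lambda>_. \<mu>))
      \<in> borel_measurable (PiM R (\<lambda>_. \<mu>))"
  proof -
    interpret PS: prob_space "PiM S (\<lambda>_. \<mu>)"
      by (intro prob_space_PiM \<mu>)
    have "(\<lambda>p. indicator (cut_event \<mu> I a b j S) (merge R S p) :: ennreal)
        \<in> borel_measurable (PiM R (\<lambda>_. \<mu>) \<Otimes>\<^sub>M PiM S (\<lambda>_. \<mu>))"
      using C R(4) by (intro measurable_compose[OF measurable_merge]) simp
    then show ?thesis
      by (intro PS.borel_measurable_nn_integral) (simp add: case_prod_beta')
  qed
  have "emeasure (PiM I (\<lambda>_. \<mu>)) ?E
      = (\<integral>\<^sup>+ x. (\<integral>\<^sup>+ y. indicator ?E (merge R S (x, y)) \<partial>PiM S (\<lambda>_. \<mu>)) \<partial>PiM R (\<lambda>_. \<mu>))"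
    by (rule fold[OF E])
  also have "\<dots> \<le> (\<integral>\<^sup>+ x. q * (\<integral>\<^sup>+ y. indicator (cut_event \<mu> I a b j S) (merge R S (x, y)) \<partial>PiM S (\<lambda>_. \<mu>))
      \<partial>PiM R (\<lambda>_. \<mu>))"
  proof (intro nn_integral_mono)
    fix x assume x: "x \<in> space (PiM R (\<lambda>_. \<mu>))"
    let ?G = "\<lambda>P. {z \<in> space (PiM S (\<lambda>_. \<mu>)). P z \<and> (\<forall>i\<in>S. z i < x j)}"
    have merge: "merge R S (x, y) ` S = y ` S" "merge R S (x, y) j = x j"
       "\<And>i. i \<in> S \<Longrightarrow> merge R S (x, y) i = y i" "\<And>i. i \<in> R \<Longrightarrow> merge R S (x, y) i = x i"
      if "y \<in> space (PiM S (\<lambda>_. \<mu>))" for y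
      using R that by (auto simp: merge_def image_iff intro: rev_bexI)
    have space: "merge R S (x, y) \<in> space (PiM I (\<lambda>_. \<mu>))" if "y \<in> space (PiM S (\<lambda>_. \<mu>))" for y
      using measurable_space[OF measurable_merge[of R S "\<lambda>_. \<mu>"], of "(x, y)"] x that R(4)
      by (simp add: space_pair_measure)
    show "(\<integral>\<^sup>+ y. indicator ?E (merge R S (x, y)) \<partial>PiM S (\<lambda>_. \<mu>))
        \<le> q * (\<integral>\<^sup>+ y. indicator (cut_event \<mu> I a b j S) (merge R S (x, y)) \<partial>PiM S (\<lambda>_. \<mu>))"
    proof (cases "a \<le> x j \<and> x j < b \<and> (\<forall>i\<in>R - {j}. x j < x i)")
      case True
      have cut: "merge R S (x, y) \<in> cut_event \<mu> I a b j S \<longleftrightarrow> (\<forall>i\<in>S. y i < x j)"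
        if "y \<in> space (PiM S (\<lambda>_. \<mu>))" for y
        using True space[OF that] by (auto simp: cut_event_def merge[OF that] R_def[symmetric])
      have "{..<a} \<subseteq> {..<x j}" using True by auto
      then have "emeasure \<mu> {..<a} \<le> emeasure \<mu> {..<x j}"
        by (intro emeasure_mono) (auto simp: sets)
      then have a': "emeasure \<mu> {..<x j} \<noteq> 0" using a by (metis le_zero_eq)
      have mcoord: "(\<lambda>z. z i) \<in> borel_measurable (PiM S (\<lambda>_. \<mu>))" if "i \<in> S" for i
        by (rule measurable_PiM_coordinate[OF sets that])
      have m1: "{z \<in> space (PiM S (\<lambda>_. \<mu>)). \<forall>i\<in>S. z i < x j} \<in> sets (PiM S (\<lambda>_. \<mu>))"
        using R(3) by (intro sets.sets_Collect_finite_All borel_measurable_less mcoord) auto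
      have m2: "{z \<in> space (PiM S (\<lambda>_. \<mu>)). D (z ` S) \<and> (\<forall>i\<in>S. z i < x j)} \<in> sets (PiM S (\<lambda>_. \<mu>))"
        using m1 borel_point_propertyD[OF D R(3) sets] by (intro sets.sets_Collect_conj)
      have "(\<integral>\<^sup>+ y. indicator ?E (merge R S (x, y)) \<partial>PiM S (\<lambda>_. \<mu>))
          = (\<integral>\<^sup>+ y. indicator {z \<in> space (PiM S (\<lambda>_. \<mu>)). D (z ` S) \<and> (\<forall>i\<in>S. z i < x j)} y \<partial>PiM S (\<lambda>_. \<mu>))"
        using space by (intro nn_integral_cong) (auto simp: indicator_def merge cut)
      also have "\<dots> \<le> q * emeasure (PiM S (\<lambda>_. \<mu>)) {z \<in> space (PiM S (\<lambda>_. \<mu>)). \<forall>i\<in>S. z i < x j}"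
        using emeasure_PiM_below_le[OF \<mu> sets D a' R(3) I(4) q] True m2 by simp
      also have "emeasure (PiM S (\<lambda>_. \<mu>)) {z \<in> space (PiM S (\<lambda>_. \<mu>)). \<forall>i\<in>S. z i < x j}
          = (\<integral>\<^sup>+ y. indicator (cut_event \<mu> I a b j S) (merge R S (x, y)) \<partial>PiM S (\<lambda>_. \<mu>))"
        by (subst nn_integral_indicator[OF m1, symmetric], intro nn_integral_cong)
           (auto simp: indicator_def cut)
      finally show ?thesis .
    next
      case False
      then have "merge R S (x, y) \<notin> cut_event \<mu> I a b j S" if "y \<in> space (PiM S (\<lambda>_. \<mu>))" for y
        by (auto simp: cut_event_def merge[OF that] R_def[symmetric])
      then have "(\<integral>\<^sup>+ y. indicator ?E (merge R S (x, y)) \<partial>PiM S (\<lambda>_. \<mu>))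
          = (\<integral>\<^sup>+ y. 0 \<partial>PiM S (\<lambda>_. \<mu>))"
        by (intro nn_integral_cong) auto
      then show ?thesis by simp
    qed
  qed
  also have "\<dots> = q * emeasure (PiM I (\<lambda>_. \<mu>)) (cut_event \<mu> I a b j S)"
    using meas by (simp add: nn_integral_cmult fold[OF C])
  finally show ?thesis .
qed

text \<open>
  Summing the previous bound over the disjoint cut events costs nothing, because their
  probabilities add up to at most 1.  The set \<open>B\<close> absorbs the samples whose \<open>(n + 1)\<close>-st smallest point
  falls outside \<open>[a, b)\<close>.  Together this is the upper half of the statement that the \<open>n\<close>
  smallest points are a mixture of samples truncated at \<open>y\<close>; the lower half follows by
  applying it to the negation of \<open>D\<close>.
\<close>
theorem emeasure_lowest_points_le:
  fixes \<mu> :: "real measure" and I :: "nat set"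
  assumes \<mu>: "prob_space \<mu>" and sets: "sets \<mu> = sets borel" and D: "borel_point_property D"
    and atomless: "\<And>x. emeasure \<mu> {x} = 0"
    and a: "emeasure \<mu> {..<a} \<noteq> 0" 
    and q: "\<And>y. \<lbrakk>a \<le> y; y < b\<rbrakk> \<Longrightarrow> emeasure (PiM {..<n} (\<lambda>_. uniform_measure \<mu> {..<y}))
      {z \<in> space (PiM {..<n} (\<lambda>_. uniform_measure \<mu> {..<y})). D (z ` {..<n})} \<le> q"
    and I: "finite I"
    and B: "B \<in> sets (PiM I (\<lambda>_. \<mu>))"
    and count: "\<And>z. z \<in> space (PiM I (\<lambda>_. \<mu>)) - B \<Longrightarrow>
      card {i \<in> I. z i < a} \<le> n \<and> n < card {i \<in> I. z i < b}"
  shows "emeasure (PiM I (\<lambda>_. \<mu>)) {z \<in> space (PiM I (\<lambda>_. \<mu>)). D (z ` lowest_indices n I z)}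
       \<le> q + emeasure (PiM I (\<lambda>_. \<mu>)) B"
proof -
  let ?P = "PiM I (\<lambda>_. \<mu>)"
  interpret P: prob_space ?P
    by (intro prob_space_PiM \<mu>)
  define J where "J = {(j, S). j \<in> I \<and> S \<subseteq> I - {j} \<and> card S = n}"
  have J: "finite J"
    by (rule finite_subset[of _ "I \<times> Pow I"]) (use I in \<open>auto simp: J_def\<close>)
  define C where "C = (\<lambda>(j, S). cut_event \<mu> I a b j S)"
  define E where "E = (\<lambda>(j, S). {z \<in> space ?P. D (z ` S)} \<inter> cut_event \<mu> I a b j S)"
  have C: "C p \<in> P.events" if "p \<in> J" for p
    using that I sets by (auto simp: J_def C_def intro!: sets_cut_event)
  have E: "E p \<in> P.events" if "p \<in> J" for p
    using that I sets D
    by (auto simp: J_def E_def intro!: sets_cut_event sets.Int sets_point_property_subset)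
  have disj: "disjoint_family_on C J"
    unfolding disjoint_family_on_def C_def J_def using cut_event_disjoint[OF I] by fastforce
  have "AE z in ?P. z \<in> {z \<in> space ?P. D (z ` lowest_indices n I z)} \<longrightarrow> z \<in> (\<Union>p\<in>J. E p) \<union> B"
    using AE_PiM_inj_on[OF \<mu> sets atomless I] AE_space
  proof eventually_elim
    case (elim z)
    show ?case
    proof (intro impI)
      assume D: "z \<in> {z \<in> space ?P. D (z ` lowest_indices n I z)}"
      show "z \<in> (\<Union>p\<in>J. E p) \<union> B"
      proof (cases "z \<in> B")
        case False
        with count[of z] elim obtain j where "j \<in> I" "lowest_indices n I z \<subseteq> I - {j}" "card (lowest_indices n I z) = n"
          "z \<in> cut_event \<mu> I a b j (lowest_indices n I z)"
          using ex_cut_event[OF elim(2) I elim(1), of a n b] by auto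
        with D show ?thesis
          by (auto simp: J_def E_def)
      qed simp
    qed
  qed
  then have "emeasure ?P {z \<in> space ?P. D (z ` lowest_indices n I z)} \<le> emeasure ?P ((\<Union>p\<in>J. E p) \<union> B)"
    using J E B by (intro emeasure_mono_AE sets.Un sets.finite_UN) auto
  also have "\<dots> \<le> emeasure ?P (\<Union>p\<in>J. E p) + emeasure ?P B"
    using J E B by (intro emeasure_subadditive) auto
  also have "emeasure ?P (\<Union>p\<in>J. E p) \<le> (\<Sum>p\<in>J. emeasure ?P (E p))"
    using J E by (intro emeasure_subadditive_finite) auto
  also have "\<dots> \<le> (\<Sum>p\<in>J. q * emeasure ?P (C p))"
    using emeasure_cut_event_le[OF \<mu> sets D a q I] by (intro sum_mono) (auto simp: J_def E_def C_def)
  also have "\<dots> = q * emeasure ?P (\<Union>p\<in>J. C p)"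
    using J C disj by (subst sum_emeasure[symmetric]) (auto simp: sum_distrib_left)
  also have "\<dots> \<le> q * 1"
    by (intro mult_left_mono P.emeasure_le_1) auto
  finally show ?thesis by (simp add: add_right_mono)
qed

section \<open>Location of the smallest discarded point\<close>

lemma Hoeffding_ineq_count:
  fixes \<mu> :: "real measure" and I :: "nat set"
  assumes \<mu>: "prob_space \<mu>" and sets: "sets \<mu> = sets borel" and I: "finite I" "I \<noteq> {}" and t: "t \<ge> 0"
  shows "\<P>(z in PiM I (\<lambda>_. \<mu>). real (card {i \<in> I. z i < c}) \<ge> card I * measure \<mu> {..<c} + t)
           \<le> exp (- 2 * t\<^sup>2 / card I)"
    and "\<P>(z in PiM I (\<lambda>_. \<mu>). real (card {i \<in> I. z i < c}) \<le> card I * measure \<mu> {..<c} - t)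
           \<le> exp (- 2 * t\<^sup>2 / card I)"
proof -
  let ?P = "PiM I (\<lambda>_. \<mu>)" and ?Y = "indicator {..<c} :: real \<Rightarrow> real"
  interpret \<mu>: prob_space \<mu> by fact
  interpret P: prob_space ?P by (intro prob_space_PiM \<mu>)
  have space: "space \<mu> = UNIV"
    using sets_eq_imp_space_eq[OF sets] by simp
  have rv: "(\<lambda>z. z i) \<in> borel_measurable ?P" if "i \<in> I" for i
    by (rule measurable_PiM_coordinate[OF sets that])
  have distr: "distr ?P borel (\<lambda>z. z i) = \<mu>" if "i \<in> I" for i
    using distr_PiM_component[of I "\<lambda>_. \<mu>" i] \<mu> that distr_cong[OF refl sets, of ?P] by metis
  interpret H: Hoeffding_ineq ?P I "\<lambda>i z. ?Y (z i)" "\<lambda>_. 0" "\<lambda>_. 1" "card I * measure \<mu> {..<c}"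
  proof unfold_locales
    show "P.indep_vars (\<lambda>_. borel) (\<lambda>i z. ?Y (z i)) I"
      by (rule P.indep_vars_compose2[OF indep_vars_PiM_coordinates[OF \<mu> sets I(2)]]) measurable
    have "P.expectation (\<lambda>z. ?Y (z i)) = measure \<mu> {..<c}" if "i \<in> I" for i
    proof -
      have "P.expectation (\<lambda>z. ?Y (z i)) = (\<integral>x. ?Y x \<partial>distr ?P borel (\<lambda>z. z i))"
        using rv[OF that] by (subst integral_distr) auto
      then show ?thesis using sets by (simp add: distr[OF that] space)
    qed
    then show "card I * measure \<mu> {..<c} \<equiv> \<Sum>i\<in>I. P.expectation (\<lambda>z. ?Y (z i))"
      by simp
  qed (use I in \<open>auto simp: indicator_def\<close>)
  have count: "(\<Sum>i\<in>I. ?Y (z i)) = real (card {i \<in> I. z i < c})" for z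
    using I by (simp add: indicator_def if_distrib sum.If_cases Int_def flip: sum.inter_filter)
  show "\<P>(z in PiM I (\<lambda>_. \<mu>). real (card {i \<in> I. z i < c}) \<ge> card I * measure \<mu> {..<c} + t)
           \<le> exp (- 2 * t\<^sup>2 / card I)"
    using H.Hoeffding_ineq_ge[OF t] I by (simp add: count card_gt_0_iff)
  show "\<P>(z in PiM I (\<lambda>_. \<mu>). real (card {i \<in> I. z i < c}) \<le> card I * measure \<mu> {..<c} - t)
           \<le> exp (- 2 * t\<^sup>2 / card I)"
    using H.Hoeffding_ineq_le[OF t] I by (simp add: count card_gt_0_iff)
qed

text \<open>
  The \<open>(n + 1)\<close>-st smallest point is below \<open>a\<close>, or it is at least \<open>b\<close> (or does not exist).
\<close>
definition misplaced_event :: "real measure \<Rightarrow> nat set \<Rightarrow> real \<Rightarrow> real \<Rightarrow> nat \<Rightarrow> (nat \<Rightarrow> real) set" where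
  "misplaced_event \<mu> I a b n = {z \<in> space (PiM I (\<lambda>_. \<mu>)).
     n < card {i \<in> I. z i < a} \<or> card {i \<in> I. z i < b} \<le> n}"

lemma sets_misplaced_event:
  assumes sets: "sets \<mu> = sets borel"
  shows "misplaced_event \<mu> I a b n \<in> sets (PiM I (\<lambda>_. \<mu>))"
proof -
  let ?P = "PiM I (\<lambda>_. \<mu>)"
  have *: "misplaced_event \<mu> I a b n = {z \<in> space ?P. n < card {i \<in> I. z i < a}} \<union>
      {z \<in> space ?P. card {i \<in> I. z i < b} < Suc n}"
    by (auto simp: misplaced_event_def)
  show ?thesis
    unfolding * by (intro sets.Un sets_Collect_card_less sets_Collect_PiM_less(2) sets)
qed

text \<open>
  The number of points below \<open>a\<close> has mean \<open>N * q\<close>, where \<open>q < p\<close> is the measure of \<open>{..<a}\<close>,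
  whereas \<open>n\<close> is about \<open>N * p\<close>; so exceeding \<open>n\<close> is a deviation of order \<open>N\<close>, which has
  probability exponentially small in \<open>N\<close>.  The
  same holds for falling short of \<open>n + 1\<close> points below \<open>b\<close>.
\<close>
lemma misplaced_event_tendsto_0:
  fixes \<mu> :: "real measure" and N :: "nat \<Rightarrow> nat" and p :: real
  assumes \<mu>: "prob_space \<mu>" and sets: "sets \<mu> = sets borel"
    and ab: "measure \<mu> {..<a} < p" "p < measure \<mu> {..<b}"
    and N: "\<And>n. N n * p \<le> n" "\<And>n. n \<le> (N n + 1) * p" "filterlim N at_top sequentially"
  shows "(\<lambda>n. measure (PiM {..<N n} (\<lambda>_. \<mu>)) (misplaced_event \<mu> {..<N n} a b n)) \<longlonglongrightarrow> 0"
proof -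
  define s where "s = p - measure \<mu> {..<a}"
  \<comment> \<open>Half of the gap at \<open>b\<close> is left to pay for the rounding in \<open>N n\<close>, which costs at most \<open>p\<close>.\<close>
  define t where "t = (measure \<mu> {..<b} - p) / 2"
  have st: "s > 0" "t > 0" using ab by (auto simp: s_def t_def)
  have N': "filterlim (\<lambda>n. real (N n)) at_top sequentially"
    using N(3) filterlim_compose[OF filterlim_real_sequentially] by blast
  have exp: "(\<lambda>n. exp (- 2 * c\<^sup>2 * real (N n))) \<longlonglongrightarrow> 0" if "c > 0" for c :: real
  proof -
    have "filterlim (\<lambda>n. - 2 * c\<^sup>2 * real (N n)) at_bot sequentially"
      by (rule filterlim_tendsto_neg_mult_at_bot[OF tendsto_const _ N']) (use that in auto)
    then show ?thesis
      by (rule filterlim_compose[OF exp_at_bot])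
  qed
  have bound: "\<forall>\<^sub>F n in sequentially.
      measure (PiM {..<N n} (\<lambda>_. \<mu>)) (misplaced_event \<mu> {..<N n} a b n)
      \<le> exp (- 2 * s\<^sup>2 * real (N n)) + exp (- 2 * t\<^sup>2 * real (N n))"
  proof -
    have "\<forall>\<^sub>F n in sequentially. real (N n) \<ge> max 1 (p / t)"
      using N' unfolding filterlim_at_top by blast
    then show ?thesis
    proof eventually_elim
      case (elim n)
      let ?I = "{..<N n}"
      let ?P = "PiM ?I (\<lambda>_. \<mu>)"
      interpret P: prob_space ?P by (intro prob_space_PiM \<mu>)
      have I: "finite ?I" "?I \<noteq> {}" "card ?I = N n" and Npos: "real (N n) > 0"
        using elim by (auto simp: lessThan_empty_iff bot_nat_def)
      let ?A = "{z \<in> space ?P. real (card {i \<in> ?I. z i < a}) \<ge> N n * measure \<mu> {..<a} + N n * s}"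
      let ?B = "{z \<in> space ?P. real (card {i \<in> ?I. z i < b}) \<le> N n * measure \<mu> {..<b} - N n * t}"
      have meas: "(\<lambda>z. real (card {i \<in> ?I. z i < c})) \<in> borel_measurable ?P" for c
        using measurable_card_Collect[OF sets_Collect_PiM_less(2)[OF sets]]
        by (rule measurable_compose) measurable
      have AB: "?A \<in> P.events" "?B \<in> P.events"
        by (rule borel_measurable_le[OF borel_measurable_const meas]
            borel_measurable_le[OF meas borel_measurable_const])+
      have low: "N n * measure \<mu> {..<a} + N n * s \<le> real n"
      proof -
        have "N n * s = N n * p - N n * measure \<mu> {..<a}"
          unfolding s_def by (rule right_diff_distrib)
        then show ?thesis using N(1)[of n] by linarith
      qed
      have "p \<le> N n * t" using elim st by (simp add: pos_divide_le_eq)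
      moreover have "N n * measure \<mu> {..<b} - N n * t = N n * p + N n * t"
      proof -
        have "x = p + 2 * ((x - p) / 2)" for x by (simp add: field_simps)
        then have "measure \<mu> {..<b} = p + 2 * t" unfolding t_def by blast
        then show ?thesis by (simp only:) (simp add: algebra_simps)
      qed
      moreover have "real n \<le> N n * p + p"
        using N(2)[of n] by (simp add: distrib_right)
      ultimately have high: "real n \<le> N n * measure \<mu> {..<b} - N n * t"
        by linarith
      have "misplaced_event \<mu> ?I a b n \<subseteq> ?A \<union> ?B"
      proof
        fix z assume z: "z \<in> misplaced_event \<mu> ?I a b n"
        then have "real n < real (card {i \<in> ?I. z i < a}) \<or> real (card {i \<in> ?I. z i < b}) \<le> real n"
          unfolding misplaced_event_def by simp
        then have "real (card {i \<in> ?I. z i < a}) \<ge> N n * measure \<mu> {..<a} + N n * s \<or>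
            real (card {i \<in> ?I. z i < b}) \<le> N n * measure \<mu> {..<b} - N n * t"
          using low high by linarith
        then show "z \<in> ?A \<union> ?B"
          using z unfolding misplaced_event_def by blast
      qed
      then have "P.prob (misplaced_event \<mu> ?I a b n) \<le> P.prob (?A \<union> ?B)"
        by (rule P.finite_measure_mono[OF _ sets.Un[OF AB]])
      also have "\<dots> \<le> P.prob ?A + P.prob ?B"
        by (rule measure_Un_le[OF AB])
      also have "\<dots> \<le> exp (- 2 * (N n * s)\<^sup>2 / N n) + exp (- 2 * (N n * t)\<^sup>2 / N n)"
        using Hoeffding_ineq_count(1)[OF \<mu> sets I(1,2), of "N n * s" a]
          Hoeffding_ineq_count(2)[OF \<mu> sets I(1,2), of "N n * t" b] st
        by (intro add_mono) simp_all
      also have "- 2 * (N n * s)\<^sup>2 / N n = - 2 * s\<^sup>2 * real (N n)"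
        using Npos by (simp add: power2_eq_square)
      also have "- 2 * (N n * t)\<^sup>2 / N n = - 2 * t\<^sup>2 * real (N n)"
        using Npos by (simp add: power2_eq_square)
      finally show ?case .
    qed
  qed
  have lim: "(\<lambda>n. exp (- 2 * s\<^sup>2 * real (N n)) + exp (- 2 * t\<^sup>2 * real (N n))) \<longlonglongrightarrow> 0"
    using tendsto_add[OF exp[OF st(1)] exp[OF st(2)]] by simp
  show ?thesis
    by (rule tendsto_sandwich[OF _ bound tendsto_const lim]) simp
qed

section \<open>Exponential points below a truncation level\<close>

text \<open>
  The quantile function of the exponential law with rate \<open>l\<close> conditioned on values below \<open>y\<close>.
\<close>
definition trunc_exp_quantile :: "real \<Rightarrow> real \<Rightarrow> real \<Rightarrow> real" where
  "trunc_exp_quantile l y u = - ln (1 - (1 - exp (- l * y)) * u) / l"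

lemma trunc_exp_quantile_measurable [measurable]:
  "trunc_exp_quantile l y \<in> borel_measurable borel"
  unfolding trunc_exp_quantile_def by measurable

lemma trunc_exp_quantile_arg_pos:
  fixes l y u :: real
  assumes "l > 0" "u \<in> {0..1}"
  shows "1 - (1 - exp (- l * y)) * u > 0"
proof -
  have "(1 - u) + exp (- l * y) * u > 0"
    using assms by (cases "u = 1") (auto intro: add_pos_nonneg)
  then show ?thesis by (simp add: algebra_simps)
qed

lemma trunc_exp_quantile_le_iff:
  assumes "l > 0" "y > 0" "u \<in> {0..1}"
  shows "trunc_exp_quantile l y u \<le> x \<longleftrightarrow> u \<le> (1 - exp (- l * x)) / (1 - exp (- l * y))"
proof -
  let ?w = "1 - (1 - exp (- l * y)) * u"
  have pos: "?w > 0" using trunc_exp_quantile_arg_pos assms by blast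
  have "trunc_exp_quantile l y u \<le> x \<longleftrightarrow> - l * x \<le> ln ?w"
    using assms by (auto simp: trunc_exp_quantile_def field_simps)
  also have "\<dots> \<longleftrightarrow> exp (- l * x) \<le> ?w"
    using pos by (metis exp_le_cancel_iff exp_ln)
  also have "\<dots> \<longleftrightarrow> u \<le> (1 - exp (- l * x)) / (1 - exp (- l * y))"
    using assms by (subst pos_le_divide_eq) (auto simp: mult.commute)
  finally show ?thesis .
qed

lemma prob_space_exponential:
  "l > 0 \<Longrightarrow> prob_space (density lborel (\<lambda>x. ennreal (exponential_density l x)))"
  by (rule prob_space_exponential_density)

lemma measure_exponential_atMost:
  assumes "l > 0"
  shows "measure (density lborel (\<lambda>x. ennreal (exponential_density l x))) {..a}
       = (if a < 0 then 0 else 1 - exp (- l * a))"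
  using emeasure_erlang_density[OF assms, of 0 a] assms
  by (auto simp: measure_def erlang_CDF_def mult.commute)

lemma emeasure_exponential_singleton:
  "emeasure (density lborel (\<lambda>x. ennreal (exponential_density l x))) {a} = 0"
  by (subst emeasure_density) (auto intro!: nn_integral_null_set simp: mult.commute null_sets_def)

lemma measure_exponential_lessThan:
  assumes "l > 0"
  shows "measure (density lborel (\<lambda>x. ennreal (exponential_density l x))) {..<a}
       = (if a < 0 then 0 else 1 - exp (- l * a))"
proof -
  let ?\<mu> = "density lborel (\<lambda>x. ennreal (exponential_density l x))"
  interpret prob_space ?\<mu> by (rule prob_space_exponential[OF assms])
  have "measure ?\<mu> {..a} = measure ?\<mu> {..<a} + measure ?\<mu> {a}"
    by (subst finite_measure_Union[symmetric]) (auto intro!: arg_cong[of _ _ "measure ?\<mu>"])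
  then show ?thesis
    using emeasure_exponential_singleton[of l a] measure_exponential_atMost[OF assms, of a]
    by (simp add: measure_def)
qed

lemma emeasure_exponential_lessThan_nonzero:
  assumes "l > 0" "a > 0"
  shows "emeasure (density lborel (\<lambda>x. ennreal (exponential_density l x))) {..<a} \<noteq> 0"
  using measure_exponential_lessThan[OF assms(1), of a] assms by (auto simp: measure_def)

lemma uniform_measure_exponential_eq_distr:
  assumes l: "l > 0" and y: "y > 0"
  shows "uniform_measure (density lborel (\<lambda>x. ennreal (exponential_density l x))) {..<y}
       = distr (uniform_measure lborel {0..1}) borel (trunc_exp_quantile l y)"
proof (rule cdf_unique)
  let ?\<mu> = "density lborel (\<lambda>x. ennreal (exponential_density l x))"
  let ?U = "uniform_measure lborel {0..1::real}"
  interpret \<mu>: prob_space ?\<mu> by (rule prob_space_exponential[OF l])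
  interpret U: prob_space ?U by (rule prob_space_uniform_measure) auto
  interpret N: prob_space "uniform_measure ?\<mu> {..<y}"
    using emeasure_exponential_lessThan_nonzero[OF l y] \<mu>.emeasure_finite
    by (intro prob_space_uniform_measure) auto
  interpret Q: prob_space "distr ?U borel (trunc_exp_quantile l y)"
    by (rule U.prob_space_distr) measurable
  show "real_distribution (uniform_measure ?\<mu> {..<y})"
    by (simp add: real_distribution_def real_distribution_axioms_def N.prob_space_axioms)
  show "real_distribution (distr ?U borel (trunc_exp_quantile l y))"
    by (simp add: real_distribution_def real_distribution_axioms_def Q.prob_space_axioms)
  show "cdf (uniform_measure ?\<mu> {..<y}) = cdf (distr ?U borel (trunc_exp_quantile l y))"
  proof
    fix x
    let ?t = "(1 - exp (- l * x)) / (1 - exp (- l * y))"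
    have c: "0 < 1 - exp (- l * y)" using l y by simp
    have "cdf (uniform_measure ?\<mu> {..<y}) x = measure ?\<mu> ({..<y} \<inter> {..x}) / measure ?\<mu> {..<y}"
      using emeasure_exponential_lessThan_nonzero[OF l y]
      by (simp add: cdf_def measure_uniform_measure \<mu>.emeasure_eq_measure)
    also have "{..<y} \<inter> {..x} = (if x < y then {..x} else {..<y})"
      by auto
    also have "measure ?\<mu> \<dots> / measure ?\<mu> {..<y} = (if x < 0 then 0 else if x < y then ?t else 1)"
      using c y by (auto simp: measure_exponential_atMost[OF l] measure_exponential_lessThan[OF l])
    also have "\<dots> = measure lborel ({0..1} \<inter> {..?t})"
    proof -
      consider "x < 0" | "0 \<le> x" "x < y" | "y \<le> x" by linarith
      then show ?thesis
      proof cases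
        case 1
        then have "?t < 0" using c l by (simp add: divide_less_0_iff mult_pos_neg)
        then have "{0..1} \<inter> {..?t} = {}" by auto
        then show ?thesis using 1 by simp
      next
        case 2
        then have "0 \<le> ?t" "?t \<le> 1" using c l by (auto simp: divide_le_eq_1)
        then have "{0..1} \<inter> {..?t} = {0..?t}" by auto
        then show ?thesis using 2 \<open>0 \<le> ?t\<close> by simp
      next
        case 3
        then have "1 \<le> ?t" using c l by (auto simp: le_divide_eq_1)
        then have "{0..1} \<inter> {..?t} = {0..1}" by auto
        then show ?thesis using 3 y by simp
      qed
    qed
    also have "{0..1} \<inter> {..?t} = {0..1} \<inter> {u. trunc_exp_quantile l y u \<le> x}"
      using trunc_exp_quantile_le_iff[OF l y] by auto
    also have "measure lborel \<dots> = cdf (distr ?U borel (trunc_exp_quantile l y)) x"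
      by (simp add: cdf_def measure_distr measure_uniform_measure vimage_def)
    finally show "cdf (uniform_measure ?\<mu> {..<y}) x = cdf (distr ?U borel (trunc_exp_quantile l y)) x" .
  qed
qed

lemma density_trunc_exp_eq_uniform_measure:
  assumes l: "l > 0" and T: "T > 0"
  shows "density lborel (\<lambda>x. ennreal (trunc_exp_density l T x))
       = uniform_measure (density lborel (\<lambda>x. ennreal (exponential_density l x))) {..<T}"
proof -
  let ?\<mu> = "density lborel (\<lambda>x. ennreal (exponential_density l x))"
  interpret \<mu>: prob_space ?\<mu> by (rule prob_space_exponential[OF l])
  have c: "0 < 1 - exp (- l * T)" using l T by simp
  have p: "emeasure ?\<mu> {..<T} = ennreal (1 - exp (- l * T))"
    using T by (simp add: \<mu>.emeasure_eq_measure measure_exponential_lessThan[OF l])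
  have "AE x in lborel. x \<noteq> T"
    by (rule AE_lborel_singleton)
  then have "AE x in lborel. ennreal (trunc_exp_density l T x)
      = ennreal (exponential_density l x) * (indicator {..<T} x / emeasure ?\<mu> {..<T})"
  proof eventually_elim
    case (elim x)
    then show ?case
      using c l unfolding p
      by (auto simp: trunc_exp_density_def exponential_density_def indicator_def mult.commute
          divide_ennreal ennreal_mult[symmetric] simp flip: ennreal_1)
  qed
  moreover have "trunc_exp_density l T \<in> borel_measurable borel"
    unfolding trunc_exp_density_def by measurable
  ultimately show ?thesis
    unfolding uniform_measure_def by (subst density_density_eq) (auto intro!: density_cong)
qed

lemma has_real_derivative_trunc_exp_quantile:
  assumes "l > 0" "u \<in> {0..1}"
  shows "(trunc_exp_quantile l y has_real_derivative
    (1 - exp (- l * y)) / (l * (1 - (1 - exp (- l * y)) * u))) (at u)"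
proof -
  define c where "c = 1 - exp (- l * y)"
  have "1 - c * u > 0"
    using trunc_exp_quantile_arg_pos[OF assms, of y] by (simp add: c_def)
  then have "((\<lambda>u. - ln (1 - c * u) / l) has_real_derivative c / (l * (1 - c * u))) (at u)"
    using assms(1) by (auto intro!: derivative_eq_intros)
  then show ?thesis
    unfolding trunc_exp_quantile_def c_def .
qed

lemma trunc_exp_quantile_mono:
  assumes "l > 0" "y > 0" "0 \<le> u" "u \<le> v" "v \<le> 1"
  shows "trunc_exp_quantile l y u \<le> trunc_exp_quantile l y v"
proof (rule DERIV_nonneg_imp_nondecreasing[OF assms(4)])
  fix t assume "u \<le> t" "t \<le> v"
  then have t: "t \<in> {0..1}" using assms by auto
  show "\<exists>d. (trunc_exp_quantile l y has_real_derivative d) (at t) \<and> 0 \<le> d"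
  proof (intro exI conjI)
    show "0 \<le> (1 - exp (- l * y)) / (l * (1 - (1 - exp (- l * y)) * t))"
      using trunc_exp_quantile_arg_pos[OF assms(1) t, of y] assms
      by (intro divide_nonneg_nonneg mult_nonneg_nonneg) auto
  qed (rule has_real_derivative_trunc_exp_quantile[OF assms(1) t])
qed

text \<open>
  With \<open>p\<close> and \<open>c\<close> the probabilities of values below \<open>T\<close> and \<open>y\<close>, the derivative of
  the quantile function for \<open>T\<close> divided by that for \<open>y\<close> is \<open>p * (1 - c * u) / (c * (1 - p * u))\<close>.
  This is monotone in \<open>u\<close>.  At \<open>u = 1\<close> it equals the quotient of the odds
  \<open>p / (1 - p) = exp (l * T) - 1\<close> and \<open>c / (1 - c) = exp (l * y) - 1\<close>, and at \<open>u = 0\<close> it equals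
  \<open>p / c\<close>, which is at most the larger of that quotient and 1.
\<close>
lemma dist_trunc_exp_quantile_le:
  assumes l: "l > 0" and y: "y > 0" and T: "T > 0" and K: "K \<ge> 1"
    and odds: "exp (l * T) - 1 \<le> K * (exp (l * y) - 1)"
    and uv: "u \<in> {0..1}" "v \<in> {0..1}"
  shows "dist (trunc_exp_quantile l T u) (trunc_exp_quantile l T v)
       \<le> K * dist (trunc_exp_quantile l y u) (trunc_exp_quantile l y v)"
  using uv
proof (induction u v rule: linorder_wlog)
  case (le u v)
  let ?X = "trunc_exp_quantile l"
  define p c where "p = 1 - exp (- l * T)" and "c = 1 - exp (- l * y)"
  have pc: "0 < p" "p < 1" "0 < c" "c < 1"
    using l y T by (auto simp: p_def c_def)
  have "(1 - exp (- x)) / exp (- x) = exp x - 1" for x :: real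
    by (simp add: exp_minus field_simps)
  from this[of "l * T"] this[of "l * y"]
  have "p / (1 - p) = exp (l * T) - 1" "c / (1 - c) = exp (l * y) - 1"
    by (simp_all add: p_def c_def)
  then have "p / (1 - p) \<le> K * (c / (1 - c))" using odds by simp
  then have one: "p * (1 - c) \<le> K * c * (1 - p)"
    using pc by (simp add: field_simps)
  have "(K - 1) * (p * c) \<ge> 0" using pc K by simp
  with one have zero: "p \<le> K * c" by (simp add: algebra_simps)
  \<comment> \<open>The difference \<open>K * ?X y - ?X T\<close> has a nonnegative derivative throughout \<open>[0, 1]\<close>.\<close>
  have "K * ?X y u - ?X T u \<le> K * ?X y v - ?X T v"
  proof (rule DERIV_nonneg_imp_nondecreasing[OF \<open>u \<le> v\<close>])
    fix t assume t': "u \<le> t" "t \<le> v"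
    then have t: "t \<in> {0..1}" using le by auto
    have pos: "1 - p * t > 0" "1 - c * t > 0"
      using trunc_exp_quantile_arg_pos[OF l t] by (auto simp: p_def c_def)
    \<comment> \<open>The required bound on the derivatives is affine in \<open>t\<close>, so the ends of \<open>[0, 1]\<close> suffice.\<close>
    have "(1 - t) * p + t * (p * (1 - c)) \<le> (1 - t) * (K * c) + t * (K * c * (1 - p))"
      using one zero t by (intro add_mono mult_left_mono) auto
    then have "p * (1 - c * t) \<le> K * c * (1 - p * t)" by (simp add: algebra_simps)
    then have "p / (1 - p * t) \<le> K * c / (1 - c * t)"
      using pos by (simp add: field_simps)
    then have "p / (1 - p * t) / l \<le> K * c / (1 - c * t) / l"
      using l by (intro divide_right_mono) auto
    then have "p / (l * (1 - p * t)) \<le> K * (c / (l * (1 - c * t)))"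
      by (simp add: mult.commute)
    moreover have "((\<lambda>t. K * ?X y t - ?X T t) has_real_derivative
        K * (c / (l * (1 - c * t))) - p / (l * (1 - p * t))) (at t)"
      unfolding p_def c_def
      by (intro DERIV_diff DERIV_cmult has_real_derivative_trunc_exp_quantile l t)
    ultimately show "\<exists>d. ((\<lambda>t. K * ?X y t - ?X T t) has_real_derivative d) (at t) \<and> 0 \<le> d"
      by (intro exI conjI) auto
  qed
  moreover have "?X y u \<le> ?X y v" "?X T u \<le> ?X T v"
    using le l y T by (auto intro: trunc_exp_quantile_mono)
  ultimately show ?case
    by (simp add: dist_real_def abs_of_nonpos algebra_simps)
qed (simp add: dist_commute)

text \<open>
  Both samples are images of one uniform sample under the respective quantile functions.
\<close>
lemma emeasure_iid_trunc_exp_mono: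
  fixes n :: nat
  assumes l: "l > 0" and y: "y > 0" and T: "T > 0"
    and D: "borel_point_property D" and D': "borel_point_property D'"
    and imp: "\<And>U. \<lbrakk>finite U; U \<subseteq> {0..1}; D (trunc_exp_quantile l y ` U)\<rbrakk> \<Longrightarrow> D' (trunc_exp_quantile l T ` U)"
    and \<nu>: "\<And>y. \<nu> y = uniform_measure (density lborel (\<lambda>x. ennreal (exponential_density l x))) {..<y}"
  shows "emeasure (PiM {..<n} (\<lambda>_. \<nu> y)) {z \<in> space (PiM {..<n} (\<lambda>_. \<nu> y)). D (z ` {..<n})}
       \<le> emeasure (PiM {..<n} (\<lambda>_. \<nu> T)) {z \<in> space (PiM {..<n} (\<lambda>_. \<nu> T)). D' (z ` {..<n})}"
proof -
  let ?U = "uniform_measure lborel {0..1::real}" and ?I = "{..<n}"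
  let ?P = "PiM ?I (\<lambda>_. ?U)"
  have U: "prob_space ?U" by (rule prob_space_uniform_measure) auto
  have sets: "sets (\<nu> s) = sets borel" for s by (simp add: \<nu>)
  have borel: "sets (PiM ?I (\<lambda>_. borel)) = sets (PiM ?I (\<lambda>_. \<nu> s))" for s
    by (intro sets_PiM_cong) (simp_all add: sets)
  have m: "compose ?I (trunc_exp_quantile l s) \<in> measurable ?P (PiM ?I (\<lambda>_. \<nu> s))" for s
  proof -
    have "(\<lambda>u. trunc_exp_quantile l s (u i)) \<in> borel_measurable ?P" if "i \<in> ?I" for i
      by (rule measurable_compose[OF measurable_component_singleton[OF that]]) measurable
    then show ?thesis
      unfolding compose_def measurable_cong_sets[OF refl borel[symmetric]]
      by (intro measurable_restrict) auto
  qed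
  have eq: "emeasure (PiM ?I (\<lambda>_. \<nu> s)) {z \<in> space (PiM ?I (\<lambda>_. \<nu> s)). E (z ` ?I)}
      = emeasure ?P {u \<in> space ?P. E (trunc_exp_quantile l s ` u ` ?I)}"
    and ev: "{u \<in> space ?P. E (trunc_exp_quantile l s ` u ` ?I)} \<in> sets ?P"
    if s: "s > 0" and E: "borel_point_property E" for s E
  proof -
    have distr: "\<nu> s = distr ?U (\<nu> s) (trunc_exp_quantile l s)"
      using uniform_measure_exponential_eq_distr[OF l s] distr_cong[OF refl sets, of ?U] \<nu> by metis
    have "prob_space (\<nu> s)"
      by (subst distr, rule prob_space.prob_space_distr[OF U])
         (simp add: measurable_cong_sets[OF refl sets])
    then have "distr ?P (PiM ?I (\<lambda>_. \<nu> s)) (compose ?I (trunc_exp_quantile l s))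
        = PiM ?I (\<lambda>_. distr ?U (\<nu> s) (trunc_exp_quantile l s))"
      using U by (intro distr_PiM_finite_prob_space') (auto simp: measurable_cong_sets[OF refl sets])
    then have distr': "PiM ?I (\<lambda>_. \<nu> s) = distr ?P (PiM ?I (\<lambda>_. \<nu> s)) (compose ?I (trunc_exp_quantile l s))"
      using distr by simp
    have E': "{z \<in> space (PiM ?I (\<lambda>_. \<nu> s)). E (z ` ?I)} \<in> sets (PiM ?I (\<lambda>_. \<nu> s))"
      by (rule borel_point_propertyD[OF E _ sets]) simp
    have image: "compose ?I (trunc_exp_quantile l s) u ` ?I = trunc_exp_quantile l s ` u ` ?I" for u
      by (simp add: compose_def image_image)
    have vimage: "compose ?I (trunc_exp_quantile l s) -` {z \<in> space (PiM ?I (\<lambda>_. \<nu> s)). E (z ` ?I)} \<inter> space ?P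
        = {u \<in> space ?P. E (trunc_exp_quantile l s ` u ` ?I)}"
      using measurable_space[OF m] image by auto
    show "{u \<in> space ?P. E (trunc_exp_quantile l s ` u ` ?I)} \<in> sets ?P"
      using measurable_sets[OF m E'] vimage by simp
    have "emeasure (PiM ?I (\<lambda>_. \<nu> s)) {z \<in> space (PiM ?I (\<lambda>_. \<nu> s)). E (z ` ?I)}
        = emeasure (distr ?P (PiM ?I (\<lambda>_. \<nu> s)) (compose ?I (trunc_exp_quantile l s)))
           {z \<in> space (PiM ?I (\<lambda>_. \<nu> s)). E (z ` ?I)}"
      using distr' by simp
    also have "\<dots> = emeasure ?P {u \<in> space ?P. E (trunc_exp_quantile l s ` u ` ?I)}"
      by (simp only: emeasure_distr[OF m E'] vimage)
    finally show "emeasure (PiM ?I (\<lambda>_. \<nu> s)) {z \<in> space (PiM ?I (\<lambda>_. \<nu> s)). E (z ` ?I)}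
      = emeasure ?P {u \<in> space ?P. E (trunc_exp_quantile l s ` u ` ?I)}" .
  qed
  have "AE x in ?U. x \<in> {0..1}"
    by (rule AE_uniform_measureI) auto
  then have "AE u in ?P. u i \<in> {0..1}" if "i \<in> ?I" for i
    using U that by (intro AE_PiM_component) auto
  then have "AE u in ?P. \<forall>i\<in>?I. u i \<in> {0..1}"
    by (intro AE_finite_allI) auto
  then have "AE u in ?P. u \<in> {u \<in> space ?P. D (trunc_exp_quantile l y ` u ` ?I)}
      \<longrightarrow> u \<in> {u \<in> space ?P. D' (trunc_exp_quantile l T ` u ` ?I)}"
  proof eventually_elim
    case (elim u)
    then have "u ` ?I \<subseteq> {0..1}" by blast
    then show ?case using imp[of "u ` ?I"] by simp
  qed
  then have "emeasure ?P {u \<in> space ?P. D (trunc_exp_quantile l y ` u ` ?I)}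
      \<le> emeasure ?P {u \<in> space ?P. D' (trunc_exp_quantile l T ` u ` ?I)}"
    using ev[OF T D'] by (rule emeasure_mono_AE)
  then show ?thesis
    by (simp only: eq[OF y D] eq[OF T D'])
qed

theorem prob_lowest_exponential_points_le:
  assumes l: "l > 0" and T: "T > 0" and a: "a > 0"
    and D: "borel_point_property D" and D': "borel_point_property D'"
    and imp: "\<And>U y. \<lbrakk>finite U; U \<subseteq> {0..1}; a \<le> y; y < b; D (trunc_exp_quantile l y ` U)\<rbrakk>
      \<Longrightarrow> D' (trunc_exp_quantile l T ` U)"
    and \<mu>: "\<mu> = density lborel (\<lambda>x. ennreal (exponential_density l x))"
    and I: "finite I"
  shows "\<P>(z in PiM I (\<lambda>_. \<mu>). D (z ` lowest_indices n I z))
       \<le> \<P>(z in PiM {..<n} (\<lambda>_. uniform_measure \<mu> {..<T}). D' (z ` {..<n}))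
         + measure (PiM I (\<lambda>_. \<mu>)) (misplaced_event \<mu> I a b n)"
proof -
  let ?\<nu> = "\<lambda>y. uniform_measure \<mu> {..<y}"
  have \<mu>_prob: "prob_space \<mu>" unfolding \<mu> by (rule prob_space_exponential[OF l])
  have sets: "sets \<mu> = sets borel" by (simp add: \<mu>)
  have \<nu>_prob: "prob_space (?\<nu> T)"
    using emeasure_exponential_lessThan_nonzero[OF l T] prob_space.finite_measure[OF \<mu>_prob]
    by (intro prob_space_uniform_measure) (auto simp: \<mu> finite_measure.emeasure_finite)
  interpret P: prob_space "PiM I (\<lambda>_. \<mu>)" by (intro prob_space_PiM \<mu>_prob)
  interpret Q: prob_space "PiM {..<n} (\<lambda>_. ?\<nu> T)" by (intro prob_space_PiM \<nu>_prob)
  have "emeasure (PiM I (\<lambda>_. \<mu>)) {z \<in> space (PiM I (\<lambda>_. \<mu>)). D (z ` lowest_indices n I z)}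
      \<le> emeasure (PiM {..<n} (\<lambda>_. ?\<nu> T)) {z \<in> space (PiM {..<n} (\<lambda>_. ?\<nu> T)). D' (z ` {..<n})}
        + emeasure (PiM I (\<lambda>_. \<mu>)) (misplaced_event \<mu> I a b n)"
  proof (rule emeasure_lowest_points_le[OF \<mu>_prob sets D])
    show "emeasure \<mu> {x} = 0" for x
      unfolding \<mu> by (rule emeasure_exponential_singleton)
    show "emeasure \<mu> {..<a} \<noteq> 0"
      unfolding \<mu> by (rule emeasure_exponential_lessThan_nonzero[OF l a])
    show "emeasure (PiM {..<n} (\<lambda>_. ?\<nu> y)) {z \<in> space (PiM {..<n} (\<lambda>_. ?\<nu> y)). D (z ` {..<n})}
        \<le> emeasure (PiM {..<n} (\<lambda>_. ?\<nu> T)) {z \<in> space (PiM {..<n} (\<lambda>_. ?\<nu> T)). D' (z ` {..<n})}"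
      if "a \<le> y" "y < b" for y
      by (rule emeasure_iid_trunc_exp_mono[OF l _ T D D']) (use imp that a in \<open>auto simp: \<mu>\<close>)
    show "misplaced_event \<mu> I a b n \<in> P.events"
      by (rule sets_misplaced_event[OF sets])
    show "card {i \<in> I. z i < a} \<le> n \<and> n < card {i \<in> I. z i < b}"
      if "z \<in> space (PiM I (\<lambda>_. \<mu>)) - misplaced_event \<mu> I a b n" for z
      using that by (auto simp: misplaced_event_def)
  qed (rule I)
  then show ?thesis
    by (simp add: P.emeasure_eq_measure Q.emeasure_eq_measure flip: ennreal_plus)
qed

section \<open>Thresholds and asymptotic domination\<close>

text \<open>
  The error must not depend on the cutoff, because a threshold condition evaluates the
  probabilities at a cutoff that varies with \<open>n\<close>.
\<close>
definition asymp_dominated :: "(nat \<Rightarrow> real \<Rightarrow> real) \<Rightarrow> (nat \<Rightarrow> real \<Rightarrow> real) \<Rightarrow> bool" where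
  "asymp_dominated f g \<longleftrightarrow> (\<forall>K>1. \<exists>e. e \<longlonglongrightarrow> 0 \<and>
     (\<forall>\<^sub>F n in sequentially. \<forall>r>0. f n r \<le> g n (K * r) + e n))"

lemma asymp_dominatedE:
  assumes "asymp_dominated f g" "K > 1"
  obtains e where "e \<longlonglongrightarrow> 0" "\<forall>\<^sub>F n in sequentially. \<forall>r>0. f n r \<le> g n (K * r) + e n"
proof -
  have "\<exists>e. e \<longlonglongrightarrow> 0 \<and> (\<forall>\<^sub>F n in sequentially. \<forall>r>0. f n r \<le> g n (K * r) + e n)"
    using assms unfolding asymp_dominated_def by simp
  then show thesis using that by auto
qed

lemma asymp_dominated_tendsto_0:
  fixes r r' :: "nat \<Rightarrow> real"
  assumes "asymp_dominated f g" "K > 1" "(\<lambda>n. g n (r' n)) \<longlonglongrightarrow> 0"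
    and "\<And>n r. 0 \<le> f n r" and r: "\<forall>\<^sub>F n in sequentially. r n > 0 \<and> r' n = K * r n"
  shows "(\<lambda>n. f n (r n)) \<longlonglongrightarrow> 0"
proof -
  obtain e where e: "e \<longlonglongrightarrow> 0" "\<forall>\<^sub>F n in sequentially. \<forall>r>0. f n r \<le> g n (K * r) + e n"
    by (rule asymp_dominatedE[OF assms(1,2)])
  have lim: "(\<lambda>n. g n (r' n) + e n) \<longlonglongrightarrow> 0"
    using tendsto_add[OF assms(3) e(1)] by simp
  show ?thesis
  proof (rule tendsto_sandwich[OF _ _ tendsto_const lim])
    show "\<forall>\<^sub>F n in sequentially. f n (r n) \<le> g n (r' n) + e n"
      using e(2) r by eventually_elim auto
  qed (use assms(4) in simp)
qed

lemma asymp_dominated_tendsto_1: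
  fixes r r' :: "nat \<Rightarrow> real"
  assumes "asymp_dominated f g" "K > 1" "(\<lambda>n. f n (r n)) \<longlonglongrightarrow> 1"
    and "\<And>n r. g n r \<le> 1" and r: "\<forall>\<^sub>F n in sequentially. r n > 0 \<and> r' n = K * r n"
  shows "(\<lambda>n. g n (r' n)) \<longlonglongrightarrow> 1"
proof -
  obtain e where e: "e \<longlonglongrightarrow> 0" "\<forall>\<^sub>F n in sequentially. \<forall>r>0. f n r \<le> g n (K * r) + e n"
    by (rule asymp_dominatedE[OF assms(1,2)])
  have lim: "(\<lambda>n. f n (r n) - e n) \<longlonglongrightarrow> 1"
    using tendsto_diff[OF assms(3) e(1)] by simp
  show ?thesis
  proof (rule tendsto_sandwich[OF _ _ lim tendsto_const])
    show "\<forall>\<^sub>F n in sequentially. f n (r n) - e n \<le> g n (r' n)"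
      using e(2) r by eventually_elim (auto simp: algebra_simps)
  qed (use assms(4) in simp)
qed

lemma pos_funD: "pos_fun \<delta> \<Longrightarrow> \<forall>\<^sub>F n in sequentially. \<delta> n > 0"
  unfolding pos_fun_def eventually_sequentially by blast

lemma much_less_scale:
  assumes "much_less \<delta> \<gamma>" "c \<noteq> 0"
  shows "much_less (\<lambda>n. c * \<delta> n) \<gamma>" "much_less \<delta> (\<lambda>n. c * \<gamma> n)"
proof -
  have lim: "(\<lambda>n. \<delta> n / \<gamma> n) \<longlonglongrightarrow> 0" using assms by (simp add: much_less_def)
  show "much_less (\<lambda>n. c * \<delta> n) \<gamma>"
    using tendsto_mult_left[OF lim, of c] by (simp add: much_less_def)
  show "much_less \<delta> (\<lambda>n. c * \<gamma> n)"
    using tendsto_mult_left[OF lim, of "1 / c"] assms(2) by (simp add: much_less_def)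
qed

context
  fixes M :: "'a measure" and M' :: "'b measure"
    and G :: "nat \<Rightarrow> real \<Rightarrow> 'a \<Rightarrow> 'v graph" and G' :: "nat \<Rightarrow> real \<Rightarrow> 'b \<Rightarrow> 'v graph"
    and \<Theta> :: "'v graph set" and f g :: "nat \<Rightarrow> real \<Rightarrow> real"
  defines "f \<equiv> \<lambda>n r. \<P>(\<omega> in M. G n r \<omega> \<in> \<Theta>)" and "g \<equiv> \<lambda>n r. \<P>(\<omega> in M'. G' n r \<omega> \<in> \<Theta>)"
  assumes M': "prob_space M'" and fg: "asymp_dominated f g" and gf: "asymp_dominated g f"
begin

lemma prob_bounds: "0 \<le> g n r" "g n r \<le> 1"
  unfolding g_def using prob_space.prob_le_1[OF M'] by auto

text \<open>
  Doubling or halving a cutoff function does not change how its order compares with that of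
  \<open>\<delta>\<Theta>\<close>.
\<close>
lemma weak_threshold_transfer:
  assumes "weak_threshold M G \<Theta> \<delta>\<Theta>"
  shows "weak_threshold M' G' \<Theta> \<delta>\<Theta>"
proof -
  have "(\<lambda>n. g n (\<delta> n)) \<longlonglongrightarrow> 0" if \<delta>: "pos_fun \<delta>" "much_less \<delta> \<delta>\<Theta>" for \<delta>
  proof (rule asymp_dominated_tendsto_0[OF gf, of 2])
    have "pos_fun (\<lambda>n. 2 * \<delta> n)" "much_less (\<lambda>n. 2 * \<delta> n) \<delta>\<Theta>"
      using \<delta> much_less_scale(1)[of \<delta> \<delta>\<Theta> 2] by (auto simp: pos_fun_def)
    then show "(\<lambda>n. f n (2 * \<delta> n)) \<longlonglongrightarrow> 0"
      using assms unfolding weak_threshold_def f_def by blast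
    show "\<forall>\<^sub>F n in sequentially. 0 < \<delta> n \<and> 2 * \<delta> n = 2 * \<delta> n"
      using pos_funD[OF \<delta>(1)] by simp
  qed (use prob_bounds in auto)
  moreover have "(\<lambda>n. g n (\<delta> n)) \<longlonglongrightarrow> 1" if \<delta>: "pos_fun \<delta>" "much_less \<delta>\<Theta> \<delta>" for \<delta>
  proof (rule asymp_dominated_tendsto_1[OF fg, of 2])
    have "pos_fun (\<lambda>n. 1 / 2 * \<delta> n)" "much_less \<delta>\<Theta> (\<lambda>n. 1 / 2 * \<delta> n)"
      using \<delta> much_less_scale(2)[of \<delta>\<Theta> \<delta> "1 / 2"] by (auto simp: pos_fun_def)
    then show "(\<lambda>n. f n (1 / 2 * \<delta> n)) \<longlonglongrightarrow> 1"
      using assms unfolding weak_threshold_def f_def by blast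
    show "\<forall>\<^sub>F n in sequentially. 0 < 1 / 2 * \<delta> n \<and> \<delta> n = 2 * (1 / 2 * \<delta> n)"
      using pos_funD[OF \<delta>(1)] by simp
  qed (use prob_bounds in auto)
  ultimately show ?thesis
    using assms unfolding weak_threshold_def g_def by blast
qed

text \<open>
  The factor \<open>K\<close> is chosen to lead from \<open>1 - \<epsilon>\<close> to \<open>1 - \<epsilon> / 2\<close>, respectively from
  \<open>1 + \<epsilon> / 2\<close> to \<open>1 + \<epsilon>\<close>.
\<close>
lemma strong_threshold_transfer:
  assumes "strong_threshold M G \<Theta> \<delta>\<Theta>"
  shows "strong_threshold M' G' \<Theta> \<delta>\<Theta>"
proof -
  have pos: "\<forall>\<^sub>F n in sequentially. \<delta>\<Theta> n > 0"
    using assms pos_funD unfolding strong_threshold_def by blast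
  have "(\<lambda>n. g n ((1 - \<epsilon>) * \<delta>\<Theta> n)) \<longlonglongrightarrow> 0" if \<epsilon>: "0 < \<epsilon>" "\<epsilon> < 1" for \<epsilon>
  proof (rule asymp_dominated_tendsto_0[OF gf, of "(1 - \<epsilon> / 2) / (1 - \<epsilon>)"])
    have "0 < \<epsilon> / 2" "\<epsilon> / 2 < 1" using \<epsilon> by auto
    then show "(\<lambda>n. f n ((1 - \<epsilon> / 2) * \<delta>\<Theta> n)) \<longlonglongrightarrow> 0"
      using assms unfolding strong_threshold_def f_def by blast
    show "\<forall>\<^sub>F n in sequentially. 0 < (1 - \<epsilon>) * \<delta>\<Theta> n \<and>
        (1 - \<epsilon> / 2) * \<delta>\<Theta> n = (1 - \<epsilon> / 2) / (1 - \<epsilon>) * ((1 - \<epsilon>) * \<delta>\<Theta> n)"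
      using pos by eventually_elim (use \<epsilon> in auto)
  qed (use \<epsilon> prob_bounds in auto)
  moreover have "(\<lambda>n. g n ((1 + \<epsilon>) * \<delta>\<Theta> n)) \<longlonglongrightarrow> 1" if \<epsilon>: "0 < \<epsilon>" for \<epsilon>
  proof (rule asymp_dominated_tendsto_1[OF fg, of "(1 + \<epsilon>) / (1 + \<epsilon> / 2)"])
    have "0 < \<epsilon> / 2" using \<epsilon> by auto
    then show "(\<lambda>n. f n ((1 + \<epsilon> / 2) * \<delta>\<Theta> n)) \<longlonglongrightarrow> 1"
      using assms unfolding strong_threshold_def f_def by blast
    have "(1 + \<epsilon>) / (1 + \<epsilon> / 2) * (1 + \<epsilon> / 2) = 1 + \<epsilon>" using \<epsilon> by (simp add: field_simps)
    then show "\<forall>\<^sub>F n in sequentially. 0 < (1 + \<epsilon> / 2) * \<delta>\<Theta> n \<and>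
        (1 + \<epsilon>) * \<delta>\<Theta> n = (1 + \<epsilon>) / (1 + \<epsilon> / 2) * ((1 + \<epsilon> / 2) * \<delta>\<Theta> n)"
      using pos by (auto elim!: eventually_mono intro!: mult_pos_pos add_pos_pos simp: \<epsilon> simp flip: mult.assoc)
  qed (use \<epsilon> prob_bounds in auto)
  ultimately show ?thesis
    using assms unfolding strong_threshold_def g_def by blast
qed

end

section \<open>Comparison of the two random graphs\<close>

lemma star_size_bounds:
  fixes l T p :: real
  assumes "l > 0" "T > 0"
  defines "p \<equiv> 1 - exp (- l * T)"
  shows "star_size l T n * p \<le> n" "n \<le> (star_size l T n + 1) * p"
    and "filterlim (star_size l T) at_top sequentially"
proof -
  have p: "0 < p" "p < 1" using assms by (auto simp: p_def)
  have eq: "real (star_size l T n) = real_of_int \<lfloor>real n / p\<rfloor>" for n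
    using p by (simp add: star_size_def p_def)
  have "real_of_int \<lfloor>real n / p\<rfloor> \<le> real n / p" "real n / p \<le> real_of_int \<lfloor>real n / p\<rfloor> + 1"
    by linarith+
  from this[THEN mult_right_mono, of p]
  show "star_size l T n * p \<le> n" and "n \<le> (star_size l T n + 1) * p"
    using p by (simp_all add: eq add.commute)
  have "n \<le> star_size l T n" for n
  proof -
    have "real n \<le> real n / p" using p mult_left_le[of p "real n"] by (simp add: pos_le_divide_eq)
    then show ?thesis unfolding star_size_def p_def[symmetric]
      by (rule le_nat_floor)
  qed
  then show "filterlim (star_size l T) at_top sequentially"
    by (intro filterlim_at_top_mono[OF filterlim_ident]) auto
qed

lemma prob_trunc_exp_graph:
  assumes l: "l > 0" and T: "T > 0" and \<Theta>: "graph_property \<Theta>" "upwards_closed \<Theta>"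
    and M: "prob_space M" and indep: "prob_space.indep_vars M (\<lambda>_. borel) (X n) {..<n}"
    and distr: "\<And>i. i < n \<Longrightarrow> distributed M lborel (X n i) (\<lambda>x. ennreal (trunc_exp_density l T x))"
    and n: "n \<ge> 1"
    and \<nu>: "\<nu> = uniform_measure (density lborel (\<lambda>x. ennreal (exponential_density l x))) {..<T}"
  shows "\<P>(\<omega> in M. trunc_exp_graph X n r \<omega> \<in> \<Theta>)
       = \<P>(z in PiM {..<n} (\<lambda>_. \<nu>). geometric_graph (z ` {..<n}) r \<in> \<Theta>)"
proof -
  have sets: "sets \<nu> = sets borel" by (simp add: \<nu>)
  have d: "distr M borel (X n i) = \<nu>" if "i \<in> {..<n}" for i
  proof -
    have "distr M borel (X n i) = distr M lborel (X n i)"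
      by (rule distr_cong) auto
    also have "\<dots> = density lborel (\<lambda>x. ennreal (trunc_exp_density l T x))"
      using distr that by (intro distributed_distr_eq_density) auto
    finally show ?thesis
      unfolding \<nu> density_trunc_exp_eq_uniform_measure[OF l T] .
  qed
  have "{z \<in> space (PiM {..<n} (\<lambda>_. \<nu>)). geometric_graph (z ` {..<n}) r \<in> \<Theta>} \<in> sets (PiM {..<n} (\<lambda>_. \<nu>))"
    by (rule borel_point_propertyD[OF borel_point_property_geometric_graph[OF \<Theta>] _ sets]) simp
  from prob_iid_eq_PiM[OF M indep _ d sets this] n show ?thesis
    by (simp add: trunc_exp_graph_def image_restrict_eq lessThan_empty_iff bot_nat_def)
qed

lemma prob_star_graph:
  assumes l: "l > 0" and \<Theta>: "graph_property \<Theta>" "upwards_closed \<Theta>"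
    and M: "prob_space M" and indep: "prob_space.indep_vars M (\<lambda>_. borel) Z UNIV"
    and distr: "\<And>i. distributed M lborel (Z i) (\<lambda>x. ennreal (exponential_density l x))"
    and N: "N = star_size l T n" "N \<ge> 1"
    and \<mu>: "\<mu> = density lborel (\<lambda>x. ennreal (exponential_density l x))"
  shows "\<P>(\<omega> in M. star_graph l T Z n r \<omega> \<in> \<Theta>)
       = \<P>(z in PiM {..<N} (\<lambda>_. \<mu>). geometric_graph (z ` lowest_indices n {..<N} z) r \<in> \<Theta>)"
proof -
  have sets: "sets \<mu> = sets borel" by (simp add: \<mu>)
  have d: "distr M borel (Z i) = \<mu>" for i
  proof -
    have "distr M borel (Z i) = distr M lborel (Z i)"
      by (rule distr_cong) auto
    also have "\<dots> = \<mu>"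
      unfolding \<mu> by (rule distributed_distr_eq_density[OF distr])
    finally show ?thesis .
  qed
  have indep': "prob_space.indep_vars M (\<lambda>_. borel) Z {..<N}"
    by (rule prob_space.indep_vars_subset[OF M indep]) simp
  note D = borel_point_property_geometric_graph[OF \<Theta>, of r]
  have "{z \<in> space (PiM {..<N} (\<lambda>_. \<mu>)). geometric_graph (z ` lowest_indices n {..<N} z) r \<in> \<Theta>}
      \<in> sets (PiM {..<N} (\<lambda>_. \<mu>))"
    by (rule sets_lowest_points[OF D sets]) simp
  moreover have "(\<lambda>i\<in>{..<N}. z i) ` lowest_indices n {..<N} z = z ` lowest_indices n {..<N} z" for z :: "nat \<Rightarrow> real"
    by (intro image_cong) (auto simp: lowest_indices_def)
  ultimately show ?thesis
    using prob_iid_eq_PiM[OF M indep' _ d sets, of "\<lambda>z. geometric_graph (z ` lowest_indices n {..<N} z) r \<in> \<Theta>"] N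
    by (simp add: star_graph_def set_take_sort_eq_lowest_indices lowest_indices_restrict lessThan_empty_iff bot_nat_def)
qed

lemma quantile_graph_transfer:
  assumes l: "l > 0" and y: "y > 0" and T: "T > 0" and K: "K \<ge> 1" and r: "r > 0"
    and odds: "exp (l * T) - 1 \<le> K * (exp (l * y) - 1)" "exp (l * y) - 1 \<le> K * (exp (l * T) - 1)"
    and \<Theta>: "graph_property \<Theta>" "upwards_closed \<Theta>" and U: "finite U" "U \<subseteq> {0..1}"
    and graph: "geometric_graph (trunc_exp_quantile l y ` U) r \<in> \<Theta>"
  shows "geometric_graph (trunc_exp_quantile l T ` U) (K * r) \<in> \<Theta>"
proof (rule geometric_graph_transfer[OF \<Theta> U(1) _ _ graph])
  fix u v assume uv: "u \<in> U" "v \<in> U"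
  then have le: "dist (trunc_exp_quantile l T u) (trunc_exp_quantile l T v)
      \<le> K * dist (trunc_exp_quantile l y u) (trunc_exp_quantile l y v)"
    using U(2) by (intro dist_trunc_exp_quantile_le[OF l y T K odds(1)]) auto
  have ge: "dist (trunc_exp_quantile l y u) (trunc_exp_quantile l y v)
      \<le> K * dist (trunc_exp_quantile l T u) (trunc_exp_quantile l T v)"
    using U(2) uv by (intro dist_trunc_exp_quantile_le[OF l T y K odds(2)]) auto
  show "trunc_exp_quantile l y u = trunc_exp_quantile l y v \<longleftrightarrow>
      trunc_exp_quantile l T u = trunc_exp_quantile l T v"
    using le ge by auto
  assume "dist (trunc_exp_quantile l y u) (trunc_exp_quantile l y v) \<le> r"
  then have "K * dist (trunc_exp_quantile l y u) (trunc_exp_quantile l y v) \<le> K * r"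
    using K by (intro mult_left_mono) auto
  with le show "dist (trunc_exp_quantile l T u) (trunc_exp_quantile l T v) \<le> K * r"
    by (rule order_trans)
qed

text \<open>
  The first inequality compares the property itself.  The second compares its negation,
  which turns an upper bound for the \<open>n\<close> smallest points into a lower bound.
\<close>
lemma lowest_exponential_vs_trunc_exp:
  fixes l T :: real
  assumes l: "l > 0" and T: "T > 0" and \<Theta>: "graph_property \<Theta>" "upwards_closed \<Theta>" and K: "K > 1"
    and \<mu>: "\<mu> = density lborel (\<lambda>x. ennreal (exponential_density l x))"
    and \<nu>: "\<nu> = uniform_measure \<mu> {..<T}"
  obtains e where "e \<longlonglongrightarrow> 0"
    and "\<And>n r. r > 0 \<Longrightarrow>
      \<P>(z in PiM {..<star_size l T n} (\<lambda>_. \<mu>). geometric_graph (z ` lowest_indices n {..<star_size l T n} z) r \<in> \<Theta>)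
      \<le> \<P>(z in PiM {..<n} (\<lambda>_. \<nu>). geometric_graph (z ` {..<n}) (K * r) \<in> \<Theta>) + e n"
    and "\<And>n r. r > 0 \<Longrightarrow>
      \<P>(z in PiM {..<n} (\<lambda>_. \<nu>). geometric_graph (z ` {..<n}) r \<in> \<Theta>)
      \<le> \<P>(z in PiM {..<star_size l T n} (\<lambda>_. \<mu>). geometric_graph (z ` lowest_indices n {..<star_size l T n} z) (K * r) \<in> \<Theta>)
        + e n"
proof -
  have \<mu>_prob: "prob_space \<mu>" unfolding \<mu> by (rule prob_space_exponential[OF l])
  have sets: "sets \<mu> = sets borel" "sets \<nu> = sets borel" by (simp_all add: \<mu> \<nu>)
  have \<nu>_prob: "prob_space \<nu>"
    using emeasure_exponential_lessThan_nonzero[OF l T] prob_space.finite_measure[OF \<mu>_prob] unfolding \<nu>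
    by (intro prob_space_uniform_measure) (auto simp: \<mu> finite_measure.emeasure_finite)
  define E where "E = exp (l * T) - 1"
  have E: "E > 0" using l T by (simp add: E_def)
  \<comment> \<open>The truncation levels at which the odds are exactly \<open>E / K\<close> and \<open>K * E\<close>, where \<open>E\<close> are the odds at \<open>T\<close>.\<close>
  define a b where "a = ln (1 + E / K) / l" and "b = ln (1 + K * E) / l"
  have exp_ab: "exp (l * a) - 1 = E / K" "exp (l * b) - 1 = K * E"
    using E K l by (simp_all add: a_def b_def add_pos_pos)
  have T_eq: "T = ln (1 + E) / l" using l by (simp add: E_def)
  have a: "a > 0"
    unfolding a_def using E K l by (intro divide_pos_pos ln_gt_zero) auto
  have "E / K < E" "E < K * E" using E K by (simp_all add: divide_less_eq)
  then have aT: "a < T" and Tb: "T < b"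
    using l E K unfolding T_eq a_def b_def
    by (simp_all add: divide_strict_right_mono ln_less_cancel_iff add_pos_pos)
  define p where "p = 1 - exp (- l * T)"
  define N where "N = star_size l T"
  note N = star_size_bounds[OF l T, folded p_def N_def]
  define e where "e n = measure (PiM {..<N n} (\<lambda>_. \<mu>)) (misplaced_event \<mu> {..<N n} a b n)" for n
  have e: "e \<longlonglongrightarrow> 0"
    unfolding e_def
  proof (rule misplaced_event_tendsto_0[OF \<mu>_prob sets(1) _ _ N])
    show "measure \<mu> {..<a} < p" "p < measure \<mu> {..<b}"
      using l a aT Tb by (simp_all add: \<mu> measure_exponential_lessThan[OF l] p_def)
  qed
  have odds: "exp (l * T) - 1 \<le> K * (exp (l * y) - 1)" "exp (l * y) - 1 \<le> K * (exp (l * T) - 1)"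
    if "a \<le> y" "y < b" for y
  proof -
    have "exp (l * a) - 1 \<le> exp (l * y) - 1" using that l by simp
    then have "E / K \<le> exp (l * y) - 1" using exp_ab by simp
    then show "exp (l * T) - 1 \<le> K * (exp (l * y) - 1)"
      using K unfolding E_def by (simp add: pos_divide_le_eq mult.commute)
    have "exp (l * y) - 1 \<le> exp (l * b) - 1" using that l by simp
    then show "exp (l * y) - 1 \<le> K * (exp (l * T) - 1)"
      unfolding exp_ab(2) unfolding E_def .
  qed
  note D = borel_point_property_geometric_graph[OF \<Theta>]
  note not_D = borel_point_property_not[OF D]
  show thesis
  proof
    fix n and r :: real assume r: "r > 0"
    let ?I = "{..<N n}"
    interpret P: prob_space "PiM ?I (\<lambda>_. \<mu>)" by (intro prob_space_PiM \<mu>_prob)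
    interpret Q: prob_space "PiM {..<n} (\<lambda>_. \<nu>)" by (intro prob_space_PiM \<nu>_prob)
    have y_to_T: "geometric_graph (trunc_exp_quantile l T ` U) (K * r) \<in> \<Theta>"
      if "finite U" "U \<subseteq> {0..1}" "a \<le> y" "y < b" "geometric_graph (trunc_exp_quantile l y ` U) r \<in> \<Theta>" for U y
      by (rule quantile_graph_transfer[OF l _ T _ r odds[OF that(3,4)] \<Theta> that(1,2,5)]) (use that(3) a K in simp_all)
    have T_to_y: "geometric_graph (trunc_exp_quantile l y ` U) (K * r) \<in> \<Theta>"
      if "finite U" "U \<subseteq> {0..1}" "a \<le> y" "y < b" "geometric_graph (trunc_exp_quantile l T ` U) r \<in> \<Theta>" for U y
      by (rule quantile_graph_transfer[OF l T _ _ r odds(2)[OF that(3,4)] odds(1)[OF that(3,4)] \<Theta> that(1,2,5)])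
         (use that(3) a K in simp_all)
    have up: "\<P>(z in PiM ?I (\<lambda>_. \<mu>). geometric_graph (z ` lowest_indices n ?I z) r \<in> \<Theta>)
        \<le> \<P>(z in PiM {..<n} (\<lambda>_. \<nu>). geometric_graph (z ` {..<n}) (K * r) \<in> \<Theta>) + e n"
      unfolding \<nu> e_def
      by (rule prob_lowest_exponential_points_le[OF l T a D D _ \<mu>]) (simp_all add: y_to_T)
    have down: "\<P>(z in PiM ?I (\<lambda>_. \<mu>). geometric_graph (z ` lowest_indices n ?I z) (K * r) \<notin> \<Theta>)
        \<le> \<P>(z in PiM {..<n} (\<lambda>_. \<nu>). geometric_graph (z ` {..<n}) r \<notin> \<Theta>) + e n"
      unfolding \<nu> e_def
      by (rule prob_lowest_exponential_points_le[OF l T a not_D not_D _ \<mu>]) (use T_to_y in blast)+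
    have "\<P>(z in PiM ?I (\<lambda>_. \<mu>). geometric_graph (z ` lowest_indices n ?I z) (K * r) \<notin> \<Theta>)
        = 1 - \<P>(z in PiM ?I (\<lambda>_. \<mu>). geometric_graph (z ` lowest_indices n ?I z) (K * r) \<in> \<Theta>)"
      by (rule P.prob_neg, rule sets_lowest_points[OF D sets(1)]) simp
    moreover have "\<P>(z in PiM {..<n} (\<lambda>_. \<nu>). geometric_graph (z ` {..<n}) r \<notin> \<Theta>)
        = 1 - \<P>(z in PiM {..<n} (\<lambda>_. \<nu>). geometric_graph (z ` {..<n}) r \<in> \<Theta>)"
      by (rule Q.prob_neg, rule borel_point_propertyD[OF D _ sets(2)]) simp
    ultimately have down': "\<P>(z in PiM {..<n} (\<lambda>_. \<nu>). geometric_graph (z ` {..<n}) r \<in> \<Theta>)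
        \<le> \<P>(z in PiM ?I (\<lambda>_. \<mu>). geometric_graph (z ` lowest_indices n ?I z) (K * r) \<in> \<Theta>) + e n"
      using down by linarith
    show "\<P>(z in PiM {..<star_size l T n} (\<lambda>_. \<mu>). geometric_graph (z ` lowest_indices n {..<star_size l T n} z) r \<in> \<Theta>)
      \<le> \<P>(z in PiM {..<n} (\<lambda>_. \<nu>). geometric_graph (z ` {..<n}) (K * r) \<in> \<Theta>) + e n"
      using up unfolding N_def .
    show "\<P>(z in PiM {..<n} (\<lambda>_. \<nu>). geometric_graph (z ` {..<n}) r \<in> \<Theta>)
      \<le> \<P>(z in PiM {..<star_size l T n} (\<lambda>_. \<mu>). geometric_graph (z ` lowest_indices n {..<star_size l T n} z) (K * r) \<in> \<Theta>)
        + e n"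
      using down' unfolding N_def .
  qed (rule e)
qed

theorem theorem8:
  fixes l T :: real
    and \<Theta> :: "real graph set"
    and \<delta>\<Theta> :: "nat \<Rightarrow> real"
    and M :: "'a measure" and X :: "nat \<Rightarrow> nat \<Rightarrow> 'a \<Rightarrow> real"
    and M' :: "'b measure" and Z :: "nat \<Rightarrow> 'b \<Rightarrow> real"
  assumes "l > 0" and "T > 0"
    and "graph_property \<Theta>" and "upwards_closed \<Theta>"
    and "prob_space M"
    and "\<And>n. prob_space.indep_vars M (\<lambda>_. borel) (X n) {..<n}"
    and "\<And>n i. i < n \<Longrightarrow> distributed M lborel (X n i) (\<lambda>x. ennreal (trunc_exp_density l T x))"
    and "prob_space M'"
    and "prob_space.indep_vars M' (\<lambda>_. borel) Z UNIV"
    and "\<And>i. distributed M' lborel (Z i) (\<lambda>x. ennreal (exponential_density l x))"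
  shows "(weak_threshold M (trunc_exp_graph X) \<Theta> \<delta>\<Theta> \<longleftrightarrow>
            weak_threshold M' (star_graph l T Z) \<Theta> \<delta>\<Theta>) \<and>
         (strong_threshold M (trunc_exp_graph X) \<Theta> \<delta>\<Theta> \<longleftrightarrow>
            strong_threshold M' (star_graph l T Z) \<Theta> \<delta>\<Theta>)"
proof -
  let ?\<mu> = "density lborel (\<lambda>x. ennreal (exponential_density l x))"
  let ?\<nu> = "uniform_measure ?\<mu> {..<T}"
  let ?star = "\<lambda>n r. \<P>(z in PiM {..<star_size l T n} (\<lambda>_. ?\<mu>).
    geometric_graph (z ` lowest_indices n {..<star_size l T n} z) r \<in> \<Theta>)"
  let ?iid = "\<lambda>n r. \<P>(z in PiM {..<n} (\<lambda>_. ?\<nu>). geometric_graph (z ` {..<n}) r \<in> \<Theta>)"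
  let ?f = "\<lambda>n r. \<P>(\<omega> in M. trunc_exp_graph X n r \<omega> \<in> \<Theta>)"
  let ?g = "\<lambda>n r. \<P>(\<omega> in M'. star_graph l T Z n r \<omega> \<in> \<Theta>)"
  have "\<exists>e. e \<longlonglongrightarrow> 0 \<and> (\<forall>\<^sub>F n in sequentially. \<forall>r>0. ?f n r \<le> ?g n (K * r) + e n \<and> ?g n r \<le> ?f n (K * r) + e n)"
    if K: "K > 1" for K
  proof -
    obtain e where e: "e \<longlonglongrightarrow> 0"
      and star_le: "\<And>n r. r > 0 \<Longrightarrow> ?star n r \<le> ?iid n (K * r) + e n"
      and iid_le: "\<And>n r. r > 0 \<Longrightarrow> ?iid n r \<le> ?star n (K * r) + e n"
      by (rule lowest_exponential_vs_trunc_exp[OF assms(1-4) K refl refl]) blast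
    have "\<forall>\<^sub>F n in sequentially. star_size l T n \<ge> 1"
      using star_size_bounds(3)[OF assms(1,2)] unfolding filterlim_at_top by blast
    then have "\<forall>\<^sub>F n in sequentially. \<forall>r>0. ?f n r \<le> ?g n (K * r) + e n \<and> ?g n r \<le> ?f n (K * r) + e n"
      using eventually_ge_at_top[of 1]
    proof eventually_elim
      case (elim n)
      have f: "?f n r = ?iid n r" for r
        by (rule prob_trunc_exp_graph[where X = X, OF assms(1-6) _ elim(2) refl]) (rule assms(7))
      have g: "?g n r = ?star n r" for r
        by (rule prob_star_graph[OF assms(1,3,4,8-10) refl elim(1) refl])
      show ?case
        unfolding f g using iid_le star_le by blast
    qed
    with e show ?thesis by blast
  qed
  then have fg: "asymp_dominated ?f ?g" and gf: "asymp_dominated ?g ?f"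
    unfolding asymp_dominated_def by (fast elim: eventually_mono)+
  show ?thesis
    using weak_threshold_transfer[OF assms(8) fg gf] weak_threshold_transfer[OF assms(5) gf fg]
      strong_threshold_transfer[OF assms(8) fg gf] strong_threshold_transfer[OF assms(5) gf fg]
    by blast
qed

end
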